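(* Let $\alpha$ be a twisted partial action of a group $G$ on a unital ring $R$ such that every ideal $D_g$ is generated by a central idempotent $1_g$. Suppose that $G$ is an abelian group. Then the partial crossed product $R*_{\alpha}^{w}G$ is simple if and only if its center $Z(R*_{\alpha}^{w}G)$ is a field and $R$ is $\alpha$-simple.
   Context: $G$ is a group with identity $e$ and $R$ is an associative ring with identity $1_R$. A twisted partial action of $G$ on $R$ is a triple $\alpha=(\{D_g\}_{g\in G},\{\alpha_g\}_{g\in G},\{w_{g,h}\}_{(g,h)\in G\times G})$ where each $D_g$ is a two-sided ideal of $R$, $\alpha_g:D_{g^{-1}}\to D_g$ is a ring isomorphism, and $w_{g,h}$ is an invertible element of the multiplier ring of $D_gD_{gh}$, such that for all $g,h,t\in G$: (i) $D_g^2=D_g$ and $D_gD_h=D_hD_g$; (ii) $D_e=R$ and $\alpha_e=\mathrm{id}_R$; (iii) $\alpha_g(D_{g^{-1}}D_h)=D_gD_{gh}$; (iv) $\alpha_g\circ\alpha_h(a)=w_{g,h}\alpha_{gh}(a)w_{g,h}^{-1}$ for all $a\in D_{h^{-1}}D_{h^{-1}g^{-1}}$; (v) $w_{g,e}=w_{e,g}=1$ (the identity multiplier); (vi) $\alpha_g(aw_{h,t})w_{g,ht}=\alpha_g(a)w_{g,h}w_{gh,t}$ for all $a\in D_{g^{-1}}D_hD_{ht}$. Standing assumption: each $D_g$ is generated by an idempotent $1_g$ that is central in $R$. Hence $D_gD_{gh}$ is a unital ring with identity $1_g1_{gh}$, $w_{g,h}$ is identified with an invertible element of the ring $D_gD_{gh}$,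 and $w_{g,e}=w_{e,g}=1_g$. The partial crossed product $R*_{\alpha}^{w}G$ is $\bigoplus_{g\in G}D_g\delta_g$ (the $\delta_g$ are symbols) with the usual addition and multiplication $(a_g\delta_g)(b_h\delta_h)=\alpha_g(\alpha_g^{-1}(a_g)b_h)w_{g,h}\delta_{gh}$; it is an associative ring with identity $1_R\delta_e$, and $R$ is identified with $R\delta_e$. An ideal $I$ of $R$ is $\alpha$-invariant if $\alpha_g(I\cap D_{g^{-1}})\subseteq I\cap D_g$ for all $g\in G$. $R$ is $\alpha$-simple if its only $\alpha$-invariant (two-sided) ideals are the trivial ones, $\{0\}$ and $R$. *)

theory Defs
  imports "HOL-Algebra.Algebra"
begin

(* An ideal D of R generated by a central idempotent u is a ring with identity u. *)
definition unital_ideal_ring :: "('a, 'm) ring_scheme \<Rightarrow> 'a set \<Rightarrow> 'a \<Rightarrow> ('a, 'm) ring_scheme"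
  where "unital_ideal_ring R D u = R\<lparr>carrier := D, one := u\<rparr>"

(* Twisted partial actions in which every D g is generated by a central idempotent u g
   (the paper's 1_g).  Then D g D (gh) is a ring with identity u g u (gh), it coincides with its
   own multiplier ring, and w g h is a unit of that ring; all multiplier products below are
   therefore products in R, and the identity multiplier of D g is u g. *)
locale unital_twisted_partial_action = grp: group G + rng: ring R
  for G :: "('g, 'n) monoid_scheme"
    and R :: "('a, 'm) ring_scheme"
    and D :: "'g \<Rightarrow> 'a set"
    and u :: "'g \<Rightarrow> 'a"
    and \<alpha> :: "'g \<Rightarrow> 'a \<Rightarrow> 'a"
    and w :: "'g \<Rightarrow> 'g \<Rightarrow> 'a" +
  assumes u_closed: "g \<in> carrier G \<Longrightarrow> u g \<in> carrier R"
    and u_idem: "g \<in> carrier G \<Longrightarrow> u g \<otimes>\<^bsub>R\<^esub> u g = u g"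
    and u_central: "\<lbrakk>g \<in> carrier G; r \<in> carrier R\<rbrakk> \<Longrightarrow> u g \<otimes>\<^bsub>R\<^esub> r = r \<otimes>\<^bsub>R\<^esub> u g"
    and D_generated: "g \<in> carrier G \<Longrightarrow> D g = Idl\<^bsub>R\<^esub> {u g}"
    and D_ideal: "g \<in> carrier G \<Longrightarrow> ideal (D g) R"
    and \<alpha>_iso: "g \<in> carrier G \<Longrightarrow>
      \<alpha> g \<in> ring_iso (unital_ideal_ring R (D (inv\<^bsub>G\<^esub> g)) (u (inv\<^bsub>G\<^esub> g)))
                      (unital_ideal_ring R (D g) (u g))"
    and w_unit: "\<lbrakk>g \<in> carrier G; h \<in> carrier G\<rbrakk> \<Longrightarrow>
      w g h \<in> Units (unital_ideal_ring R (D g \<cdot>\<^bsub>R\<^esub> D (g \<otimes>\<^bsub>G\<^esub> h)) (u g \<otimes>\<^bsub>R\<^esub> u (g \<otimes>\<^bsub>G\<^esub> h)))"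
    and D_prod_idem: "g \<in> carrier G \<Longrightarrow> D g \<cdot>\<^bsub>R\<^esub> D g = D g"
    and D_prod_comm: "\<lbrakk>g \<in> carrier G; h \<in> carrier G\<rbrakk> \<Longrightarrow> D g \<cdot>\<^bsub>R\<^esub> D h = D h \<cdot>\<^bsub>R\<^esub> D g"
    and D_one: "D \<one>\<^bsub>G\<^esub> = carrier R"
    and \<alpha>_one: "r \<in> carrier R \<Longrightarrow> \<alpha> \<one>\<^bsub>G\<^esub> r = r"
    and \<alpha>_image: "\<lbrakk>g \<in> carrier G; h \<in> carrier G\<rbrakk> \<Longrightarrow>
      \<alpha> g ` (D (inv\<^bsub>G\<^esub> g) \<cdot>\<^bsub>R\<^esub> D h) = D g \<cdot>\<^bsub>R\<^esub> D (g \<otimes>\<^bsub>G\<^esub> h)"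
    and \<alpha>_comp: "\<lbrakk>g \<in> carrier G; h \<in> carrier G;
        a \<in> D (inv\<^bsub>G\<^esub> h) \<cdot>\<^bsub>R\<^esub> D (inv\<^bsub>G\<^esub> h \<otimes>\<^bsub>G\<^esub> inv\<^bsub>G\<^esub> g)\<rbrakk> \<Longrightarrow>
      \<alpha> g (\<alpha> h a) =
        w g h \<otimes>\<^bsub>R\<^esub> \<alpha> (g \<otimes>\<^bsub>G\<^esub> h) a \<otimes>\<^bsub>R\<^esub>
        inv\<^bsub>unital_ideal_ring R (D g \<cdot>\<^bsub>R\<^esub> D (g \<otimes>\<^bsub>G\<^esub> h)) (u g \<otimes>\<^bsub>R\<^esub> u (g \<otimes>\<^bsub>G\<^esub> h))\<^esub> (w g h)"
    and w_one_right: "g \<in> carrier G \<Longrightarrow> w g \<one>\<^bsub>G\<^esub> = u g"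
    and w_one_left: "g \<in> carrier G \<Longrightarrow> w \<one>\<^bsub>G\<^esub> g = u g"
    and w_cocycle: "\<lbrakk>g \<in> carrier G; h \<in> carrier G; t \<in> carrier G;
        a \<in> D (inv\<^bsub>G\<^esub> g) \<cdot>\<^bsub>R\<^esub> D h \<cdot>\<^bsub>R\<^esub> D (h \<otimes>\<^bsub>G\<^esub> t)\<rbrakk> \<Longrightarrow>
      \<alpha> g (a \<otimes>\<^bsub>R\<^esub> w h t) \<otimes>\<^bsub>R\<^esub> w g (h \<otimes>\<^bsub>G\<^esub> t) =
        \<alpha> g a \<otimes>\<^bsub>R\<^esub> w g h \<otimes>\<^bsub>R\<^esub> w (g \<otimes>\<^bsub>G\<^esub> h) t"

(* A formal sum of terms a_g delta_g is the finitely supported function g |-> a_g, set to zero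
   outside carrier G.  The product of two sums is the bilinear extension of
   (a_g delta_g)(b_h delta_h) = alpha_g(alpha_g^{-1}(a_g) b_h) w_{g,h} delta_{gh},
   where alpha_g^{-1} : D g -> D (g^{-1}). *)
definition crossed_product ::
  "('g, 'n) monoid_scheme \<Rightarrow> ('a, 'm) ring_scheme \<Rightarrow> ('g \<Rightarrow> 'a set) \<Rightarrow> ('g \<Rightarrow> 'a \<Rightarrow> 'a)
    \<Rightarrow> ('g \<Rightarrow> 'g \<Rightarrow> 'a) \<Rightarrow> ('g \<Rightarrow> 'a) ring"
  where "crossed_product G R D \<alpha> w =
   \<lparr>carrier = {a. (\<forall>g\<in>carrier G. a g \<in> D g) \<and> (\<forall>g. g \<notin> carrier G \<longrightarrow> a g = \<zero>\<^bsub>R\<^esub>) \<and>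
                  finite {g. a g \<noteq> \<zero>\<^bsub>R\<^esub>}},
    monoid.mult = (\<lambda>a b k.
      finsum R
        (\<lambda>(g, h). \<alpha> g (inv_into (D (inv\<^bsub>G\<^esub> g)) (\<alpha> g) (a g) \<otimes>\<^bsub>R\<^esub> b h) \<otimes>\<^bsub>R\<^esub> w g h)
        {(g, h). a g \<noteq> \<zero>\<^bsub>R\<^esub> \<and> b h \<noteq> \<zero>\<^bsub>R\<^esub> \<and> g \<otimes>\<^bsub>G\<^esub> h = k}),
    one = (\<lambda>g. if g = \<one>\<^bsub>G\<^esub> then \<one>\<^bsub>R\<^esub> else \<zero>\<^bsub>R\<^esub>),
    ring.zero = (\<lambda>g. \<zero>\<^bsub>R\<^esub>),
    ring.add = (\<lambda>a b g. a g \<oplus>\<^bsub>R\<^esub> b g)\<rparr>"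

definition invariant_ideal ::
  "('g, 'n) monoid_scheme \<Rightarrow> ('a, 'm) ring_scheme \<Rightarrow> ('g \<Rightarrow> 'a set) \<Rightarrow> ('g \<Rightarrow> 'a \<Rightarrow> 'a)
    \<Rightarrow> 'a set \<Rightarrow> bool"
  where "invariant_ideal G R D \<alpha> I \<longleftrightarrow>
    ideal I R \<and> (\<forall>g\<in>carrier G. \<alpha> g ` (I \<inter> D (inv\<^bsub>G\<^esub> g)) \<subseteq> I \<inter> D g)"

(* The zero ring counts as alpha-simple. *)
definition alpha_simple ::
  "('g, 'n) monoid_scheme \<Rightarrow> ('a, 'm) ring_scheme \<Rightarrow> ('g \<Rightarrow> 'a set) \<Rightarrow> ('g \<Rightarrow> 'a \<Rightarrow> 'a) \<Rightarrow> bool"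
  where "alpha_simple G R D \<alpha> \<longleftrightarrow>
    (\<forall>I. invariant_ideal G R D \<alpha> I \<longrightarrow> I = {\<zero>\<^bsub>R\<^esub>} \<or> I = carrier R)"

(* As usual, a simple ring is nonzero. *)
locale simple_ring = ring +
  assumes one_not_zero: "\<one> \<noteq> \<zero>"
    and ideal_trivial: "ideal I R \<Longrightarrow> I = {\<zero>} \<or> I = carrier R"

definition ring_center :: "('a, 'm) ring_scheme \<Rightarrow> ('a, 'm) ring_scheme"
  where "ring_center S =
    S\<lparr>carrier := {z \<in> carrier S. \<forall>x\<in>carrier S. z \<otimes>\<^bsub>S\<^esub> x = x \<otimes>\<^bsub>S\<^esub> z}\<rparr>"

end

theory Submission
  imports Defs
begin

text \<open>Write \<open>S\<close> for the crossed product. If \<open>S\<close> is simple, its center is a field, and an invariant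
  ideal \<open>I\<close> of \<open>R\<close> is trivial because the sums with all coefficients in \<open>I\<close> form an ideal of \<open>S\<close>.
  Conversely, let \<open>J\<close> be a nonzero ideal of \<open>S\<close> and \<open>F\<close> the support of a nonzero element of \<open>J\<close>
  with support of minimal size, translated so that \<open>F\<close> contains the identity. Since \<open>G\<close> is abelian,
  the coefficients at the identity of the elements of \<open>J\<close> supported in \<open>F\<close> form a nonzero invariant
  ideal, hence all of \<open>R\<close>. So \<open>J\<close> contains some \<open>y\<close> supported in \<open>F\<close> with coefficient \<open>1\<close> at the
  identity. The commutator of \<open>y\<close> with \<open>r \<delta>\<^sub>e\<close> or with \<open>u\<^sub>g \<delta>\<^sub>g\<close> lies in \<open>J\<close> and has smaller support, so it
  vanishes. Thus \<open>y\<close> is a nonzero element of the center, which is a field, and \<open>J = S\<close>.\<close>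

section \<open>Ideals and the center of a simple ring\<close>

lemma (in ideal) finsum_mem:
  assumes "\<And>i. i \<in> A \<Longrightarrow> f i \<in> I"
  shows "finsum R f A \<in> I"
  using assms
proof (induction A rule: infinite_finite_induct)
  case (insert i A)
  then have "f i \<oplus> finsum R f A \<in> I"
    by (intro additive_subgroup.a_closed[OF additive_subgroup_axioms]) auto
  moreover have "finsum R f (insert i A) = f i \<oplus> finsum R f A"
    using insert by (intro finsum_insert) (auto intro: Icarr)
  ultimately show ?case by simp
\<comment> \<open>A sum over an infinite set is \<open>\<zero>\<close> by convention, and an ideal
  contains \<open>\<zero>\<close>.\<close>
qed (simp_all add: finsum_infinite)

text \<open>For a nonzero central \<open>z\<close> the multiples of \<open>z\<close> form a
  two-sided ideal, so they exhaust the ring and \<open>z\<close> has an inverse. The inverse of a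
  central element is again central, hence lies in the center.\<close>

lemma (in simple_ring) field_center: "field (ring_center R)"
proof -
  let ?Z = "{z \<in> carrier R. \<forall>x\<in>carrier R. z \<otimes> x = x \<otimes> z}"
  have "subring ?Z R"
  proof (rule subringI)
    show "?Z \<subseteq> carrier R" by blast
    show "\<one> \<in> ?Z" by simp
    fix h assume h: "h \<in> ?Z"
    then show "\<ominus> h \<in> ?Z" by (auto simp: l_minus r_minus)
    fix k assume k: "k \<in> ?Z"
    show "h \<otimes> k \<in> ?Z"
    proof (intro CollectI conjI ballI)
      fix x assume x: "x \<in> carrier R"
      have c: "h \<in> carrier R" "k \<in> carrier R" "h \<otimes> x = x \<otimes> h" "k \<otimes> x = x \<otimes> k"
        using h k x by auto
      have "h \<otimes> k \<otimes> x = h \<otimes> (x \<otimes> k)" using c x by (simp only: m_assoc)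
      also have "\<dots> = x \<otimes> h \<otimes> k" using c x by (simp only: m_assoc[symmetric] m_closed)
      also have "\<dots> = x \<otimes> (h \<otimes> k)" using c x by (simp only: m_assoc)
      finally show "h \<otimes> k \<otimes> x = x \<otimes> (h \<otimes> k)" .
    qed (use h k in blast)
    show "h \<oplus> k \<in> ?Z" using h k by (auto simp: l_distr r_distr)
  qed
  then have "subcring ?Z R" by (rule subcringI) blast
  then have cring: "cring (ring_center R)"
    unfolding ring_center_def by (subst subcring_iff[symmetric]) auto
  show ?thesis
  proof (rule cring.cring_fieldI2[OF cring])
    show "\<zero>\<^bsub>ring_center R\<^esub> \<noteq> \<one>\<^bsub>ring_center R\<^esub>"
      using one_not_zero by (simp add: ring_center_def)
  next
    fix z assume "z \<in> carrier (ring_center R)" "z \<noteq> \<zero>\<^bsub>ring_center R\<^esub>"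
    then have z: "z \<in> carrier R" "\<And>x. x \<in> carrier R \<Longrightarrow> z \<otimes> x = x \<otimes> z" "z \<noteq> \<zero>"
      by (auto simp: ring_center_def)
    let ?I = "(\<lambda>x. z \<otimes> x) ` carrier R"
    have "ideal ?I R"
    proof (rule idealI[OF ring_axioms])
      show "subgroup ?I (add_monoid R)"
        by (rule add.subgroupI)
          (use z(1) in \<open>auto simp: r_distr[symmetric] r_minus[symmetric]\<close>)
    next
      fix a x assume "a \<in> ?I" and x: "x \<in> carrier R"
      then obtain s where s: "s \<in> carrier R" "a = z \<otimes> s" by auto
      have "x \<otimes> a = x \<otimes> z \<otimes> s" using s x z(1) by (simp only: m_assoc)
      also have "\<dots> = z \<otimes> (x \<otimes> s)"
        using s x z(1) by (simp only: m_assoc z(2)[OF x, symmetric])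
      finally have "x \<otimes> a = z \<otimes> (x \<otimes> s)" .
      then show "x \<otimes> a \<in> ?I" using s x by auto
      have "a \<otimes> x = z \<otimes> (s \<otimes> x)" using s x z(1) by (simp add: m_assoc)
      then show "a \<otimes> x \<in> ?I" using s x by auto
    qed
    moreover have "z \<in> ?I" using z(1) by (auto intro!: image_eqI[of _ _ \<one>])
    ultimately have "?I = carrier R" using ideal_trivial z(3) by blast
    then have "\<one> \<in> ?I" by simp
    then obtain s where s: "s \<in> carrier R" "z \<otimes> s = \<one>" by auto
    \<comment> \<open>Insert \<open>z \<otimes> s = \<one>\<close> to the right of
      \<open>s \<otimes> x\<close>, move \<open>z\<close> past \<open>x\<close>, and cancel it
      against the left \<open>s\<close>.\<close>
    have "s \<otimes> x = x \<otimes> s" if x: "x \<in> carrier R" for x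
    proof -
      have "s \<otimes> x = s \<otimes> (x \<otimes> z) \<otimes> s"
        using s x z(1) by (simp add: m_assoc)
      also have "x \<otimes> z = z \<otimes> x" using z(2)[OF x] by (rule sym)
      also have "s \<otimes> (z \<otimes> x) = s \<otimes> z \<otimes> x" using s x z(1) by (simp add: m_assoc)
      also have "s \<otimes> z = \<one>" using z(2)[OF s(1)] s(2) by simp
      also have "\<one> \<otimes> x \<otimes> s = x \<otimes> s" using x by simp
      finally show ?thesis .
    qed
    with s show "\<exists>b\<in>carrier (ring_center R). z \<otimes>\<^bsub>ring_center R\<^esub> b = \<one>\<^bsub>ring_center R\<^esub>"
      by (auto simp: ring_center_def)
  qed
qed

text \<open>No further assumption: this only makes \<open>R\<close> the implicit ring of the notation.\<close>

locale crossed_system = unital_twisted_partial_action G R D u \<alpha> w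
  for G :: "('g, 'n) monoid_scheme"
    and R :: "('a, 'm) ring_scheme" (structure)
    and D :: "'g \<Rightarrow> 'a set"
    and u :: "'g \<Rightarrow> 'a"
    and \<alpha> :: "'g \<Rightarrow> 'a \<Rightarrow> 'a"
    and w :: "'g \<Rightarrow> 'g \<Rightarrow> 'a"
begin

section \<open>Notation and arithmetic in the ideals \<open>D g\<close>\<close>

abbreviation e :: 'g where "e \<equiv> \<one>\<^bsub>G\<^esub>"

abbreviation gmult :: "'g \<Rightarrow> 'g \<Rightarrow> 'g" (infixl "\<star>" 75) where
  "g \<star> h \<equiv> g \<otimes>\<^bsub>G\<^esub> h"

abbreviation ginv :: "'g \<Rightarrow> 'g" where "ginv g \<equiv> inv\<^bsub>G\<^esub> g"

abbreviation S :: "('g \<Rightarrow> 'a) ring" where "S \<equiv> crossed_product G R D \<alpha> w"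

text \<open>As \<open>u g\<close> is central, the elements it fixes form a two-sided ideal
  containing \<open>u g\<close>, hence containing \<open>Idl {u g}\<close>; conversely
  \<open>r = u g \<otimes> r\<close> is a multiple of the generator. Membership thereby becomes an
  equation.\<close>

lemma mem_D_iff:
  assumes g: "g \<in> carrier G"
  shows "r \<in> D g \<longleftrightarrow> r \<in> carrier R \<and> u g \<otimes> r = r"
proof -
  let ?E = "{r \<in> carrier R. u g \<otimes> r = r}"
  have ug: "u g \<in> carrier R" by (rule u_closed[OF g])
  have "ideal ?E R"
  proof (rule idealI[OF rng.ring_axioms])
    show "subgroup ?E (add_monoid R)"
    proof (rule rng.add.subgroupI)
      show "?E \<noteq> {}" using ug by (auto intro!: exI[of _ \<zero>])
    next
      fix a assume "a \<in> ?E"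
      then show "\<ominus> a \<in> ?E" using ug by (simp add: rng.r_minus)
    qed (use ug in \<open>auto simp: rng.r_distr\<close>)
  next
    fix a x assume a: "a \<in> ?E" and x: "x \<in> carrier R"
    have "u g \<otimes> (x \<otimes> a) = u g \<otimes> x \<otimes> a" using a x ug by (simp add: rng.m_assoc)
    also have "\<dots> = x \<otimes> u g \<otimes> a" using u_central[OF g x] by simp
    also have "\<dots> = x \<otimes> a" using a x ug by (simp add: rng.m_assoc)
    finally show "x \<otimes> a \<in> ?E" using a x by simp
    have "u g \<otimes> (a \<otimes> x) = u g \<otimes> a \<otimes> x"
      by (rule rng.m_assoc[symmetric]) (use a x ug in auto)
    then show "a \<otimes> x \<in> ?E" using a x by simp
  qed
  then have "Idl {u g} \<subseteq> ?E"
    by (rule rng.genideal_minimal) (use ug u_idem[OF g] in simp)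
  moreover have "r \<in> Idl {u g}" if "r \<in> ?E" for r
  proof -
    interpret I: ideal "Idl {u g}" R using D_ideal[OF g] D_generated[OF g] by simp
    have "u g \<otimes> r \<in> Idl {u g}"
      using that rng.genideal_self'[OF ug] by (intro I.I_r_closed) auto
    with that show ?thesis by simp
  qed
  ultimately show ?thesis using D_generated[OF g] by auto
qed

lemma D_carr: "\<lbrakk>g \<in> carrier G; r \<in> D g\<rbrakk> \<Longrightarrow> r \<in> carrier R"
  by (simp add: mem_D_iff)

lemma D_left: "\<lbrakk>g \<in> carrier G; r \<in> D g\<rbrakk> \<Longrightarrow> u g \<otimes> r = r"
  by (simp add: mem_D_iff)

lemma D_right: "\<lbrakk>g \<in> carrier G; r \<in> D g\<rbrakk> \<Longrightarrow> r \<otimes> u g = r"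
  by (metis mem_D_iff u_central)

lemma u_in_D: "g \<in> carrier G \<Longrightarrow> u g \<in> D g"
  by (simp add: mem_D_iff u_closed u_idem)

lemma D_r_closed: "\<lbrakk>g \<in> carrier G; a \<in> D g; x \<in> carrier R\<rbrakk> \<Longrightarrow> a \<otimes> x \<in> D g"
  by (rule ideal.I_r_closed[OF D_ideal])

lemma D_l_closed: "\<lbrakk>g \<in> carrier G; a \<in> D g; x \<in> carrier R\<rbrakk> \<Longrightarrow> x \<otimes> a \<in> D g"
  by (rule ideal.I_l_closed[OF D_ideal])

lemma D_zero: "g \<in> carrier G \<Longrightarrow> \<zero> \<in> D g"
  by (simp add: mem_D_iff u_closed)

lemma D_add: "\<lbrakk>g \<in> carrier G; a \<in> D g; b \<in> D g\<rbrakk> \<Longrightarrow> a \<oplus> b \<in> D g"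
  by (simp add: mem_D_iff u_closed rng.r_distr)

lemma D_minus: "\<lbrakk>g \<in> carrier G; a \<in> D g\<rbrakk> \<Longrightarrow> \<ominus> a \<in> D g"
  by (simp add: mem_D_iff u_closed rng.r_minus)

lemma u_one: "u e = \<one>"
  using mem_D_iff[of e \<one>] D_one u_closed[of e] by simp

text \<open>For ideals with an identity, product and intersection agree:
  \<open>r = u g \<otimes> r\<close> writes an element of the intersection as a product. The axioms
  about \<open>D g \<cdot> D h\<close> are read through this.\<close>

lemma D_prod_iff:
  assumes "g \<in> carrier G" "h \<in> carrier G"
  shows "r \<in> D g \<cdot> D h \<longleftrightarrow> r \<in> D g \<and> r \<in> D h"
proof
  assume "r \<in> D g \<cdot> D h"
  then show "r \<in> D g \<and> r \<in> D h"
    using rng.ideal_prod_inter[OF D_ideal[OF assms(1)] D_ideal[OF assms(2)]] by blast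
next
  assume r: "r \<in> D g \<and> r \<in> D h"
  have "u g \<otimes> r \<in> D g \<cdot> D h"
    using r assms by (intro ideal_prod.prod u_in_D) auto
  then show "r \<in> D g \<cdot> D h" using r assms by (simp add: mem_D_iff)
qed

section \<open>The partial isomorphisms and their total extensions\<close>

lemma
  assumes g: "g \<in> carrier G"
  shows \<alpha>_in: "a \<in> D (ginv g) \<Longrightarrow> \<alpha> g a \<in> D g"
    and \<alpha>_mult: "\<lbrakk>a \<in> D (ginv g); b \<in> D (ginv g)\<rbrakk> \<Longrightarrow> \<alpha> g (a \<otimes> b) = \<alpha> g a \<otimes> \<alpha> g b"
    and \<alpha>_add: "\<lbrakk>a \<in> D (ginv g); b \<in> D (ginv g)\<rbrakk> \<Longrightarrow> \<alpha> g (a \<oplus> b) = \<alpha> g a \<oplus> \<alpha> g b"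
    and \<alpha>_unit: "\<alpha> g (u (ginv g)) = u g"
    and \<alpha>_bij: "bij_betw (\<alpha> g) (D (ginv g)) (D g)"
  using ring_iso_memE[OF \<alpha>_iso[OF g]] by (auto simp: unital_ideal_ring_def)

text \<open>The extension of \<open>\<alpha> g\<close> to a (non-unital) endomorphism of \<open>R\<close>
  killing the complement of the domain.\<close>

definition \<beta> :: "'g \<Rightarrow> 'a \<Rightarrow> 'a" where
  "\<beta> g r = \<alpha> g (u (ginv g) \<otimes> r)"

lemma u_mult_in_D: "\<lbrakk>g \<in> carrier G; r \<in> carrier R\<rbrakk> \<Longrightarrow> u g \<otimes> r \<in> D g"
  by (intro D_r_closed u_in_D)

lemma \<beta>_in_D: "\<lbrakk>g \<in> carrier G; r \<in> carrier R\<rbrakk> \<Longrightarrow> \<beta> g r \<in> D g"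
  unfolding \<beta>_def by (intro \<alpha>_in u_mult_in_D) auto

lemma \<beta>_closed: "\<lbrakk>g \<in> carrier G; r \<in> carrier R\<rbrakk> \<Longrightarrow> \<beta> g r \<in> carrier R"
  by (metis \<beta>_in_D D_carr)

lemma \<beta>_eq_\<alpha>: "\<lbrakk>g \<in> carrier G; r \<in> D (ginv g)\<rbrakk> \<Longrightarrow> \<beta> g r = \<alpha> g r"
  unfolding \<beta>_def by (simp add: D_left)

text \<open>Multiplication by the central idempotent \<open>u (ginv g)\<close> is multiplicative and
  lands in the domain of \<open>\<alpha> g\<close>, where \<open>\<alpha> g\<close> is
  multiplicative too.\<close>

lemma \<beta>_mult:
  assumes "g \<in> carrier G" "r \<in> carrier R" "s \<in> carrier R"
  shows "\<beta> g (r \<otimes> s) = \<beta> g r \<otimes> \<beta> g s"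
proof -
  let ?v = "u (ginv g)"
  have v: "?v \<in> carrier R" using assms(1) by (simp add: u_closed)
  have "?v \<otimes> r \<otimes> (?v \<otimes> s) = ?v \<otimes> (r \<otimes> ?v) \<otimes> s"
    using v assms by (simp add: rng.m_assoc)
  also have "r \<otimes> ?v = ?v \<otimes> r" using u_central[of "ginv g" r] assms by simp
  also have "?v \<otimes> (?v \<otimes> r) \<otimes> s = ?v \<otimes> ?v \<otimes> r \<otimes> s"
    using v assms by (simp add: rng.m_assoc)
  also have "\<dots> = ?v \<otimes> (r \<otimes> s)"
    using v assms u_idem[of "ginv g"] by (simp add: rng.m_assoc)
  finally show ?thesis
    unfolding \<beta>_def using \<alpha>_mult[OF assms(1), of "?v \<otimes> r" "?v \<otimes> s"] assms
    by (simp add: u_mult_in_D)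
qed

lemma \<beta>_add:
  assumes "g \<in> carrier G" "r \<in> carrier R" "s \<in> carrier R"
  shows "\<beta> g (r \<oplus> s) = \<beta> g r \<oplus> \<beta> g s"
  unfolding \<beta>_def using assms
  by (simp add: rng.r_distr u_closed \<alpha>_add u_mult_in_D)

lemma \<beta>_unit: "g \<in> carrier G \<Longrightarrow> \<beta> g \<one> = u g"
  unfolding \<beta>_def by (simp add: u_closed \<alpha>_unit)

lemma \<beta>_zero:
  assumes "g \<in> carrier G" shows "\<beta> g \<zero> = \<zero>"
  using \<beta>_add[OF assms, of \<zero> \<zero>] \<beta>_closed[OF assms, of \<zero>] by simp

lemma \<beta>_one: "r \<in> carrier R \<Longrightarrow> \<beta> e r = r"
  unfolding \<beta>_def by (simp add: u_one \<alpha>_one)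

text \<open>The isomorphism \<open>\<alpha> g\<close> carries \<open>D (ginv g) \<cdot> D h\<close>
  onto \<open>D g \<cdot> D (g \<star> h)\<close>, so it sends the identity \<open>?a\<close> of the
  first ring to an identity of the second, and that identity is unique.\<close>

lemma \<beta>_u:
  assumes g: "g \<in> carrier G" and h: "h \<in> carrier G"
  shows "\<beta> g (u h) = u g \<otimes> u (g \<star> h)"
proof -
  let ?a = "u (ginv g) \<otimes> u h" and ?f = "u g \<otimes> u (g \<star> h)"
  have D: "?f \<in> D g" "?f \<in> D (g \<star> h)" "?a \<in> D (ginv g)" "?a \<in> D h"
    using g h by (auto intro: u_mult_in_D D_l_closed u_in_D u_closed)
  have "?f \<in> \<alpha> g ` (D (ginv g) \<cdot> D h)"
    using D g h by (simp add: \<alpha>_image D_prod_iff)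
  then obtain x where x: "x \<in> D (ginv g)" "x \<in> D h" "\<alpha> g x = ?f"
    using g h by (auto simp: D_prod_iff)
  have "?a \<otimes> x = x"
    using x g h by (simp add: rng.m_assoc u_closed D_left D_carr)
  then have *: "\<alpha> g ?a \<otimes> ?f = ?f"
    using \<alpha>_mult[OF g D(3) x(1)] x(3) by simp
  have "\<alpha> g ?a \<in> \<alpha> g ` (D (ginv g) \<cdot> D h)"
    using D g h by (simp add: D_prod_iff)
  then have "\<alpha> g ?a \<in> D g" "\<alpha> g ?a \<in> D (g \<star> h)"
    using g h by (simp_all add: \<alpha>_image D_prod_iff)
  then have "\<alpha> g ?a \<otimes> ?f = \<alpha> g ?a"
    using g h rng.m_assoc[of "\<alpha> g ?a" "u g" "u (g \<star> h)"]
    by (simp add: D_carr D_right u_closed)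
  with * show ?thesis by (simp add: \<beta>_def)
qed

section \<open>The twist: composition and cocycle rules on all of \<open>R\<close>\<close>

lemma
  assumes "g \<in> carrier G" "h \<in> carrier G"
  shows w_in_D: "w g h \<in> D g" and w_in_D': "w g h \<in> D (g \<star> h)"
    and w_closed: "w g h \<in> carrier R"
    and w_invertible: "\<exists>v \<in> carrier R. w g h \<otimes> v = u g \<otimes> u (g \<star> h)"
  using w_unit[OF assms] assms
  by (auto simp: Units_def unital_ideal_ring_def D_prod_iff D_carr)

text \<open>This is \<open>\<alpha>_comp\<close> with the inverse of the twist cleared, extended to
  arbitrary \<open>r\<close>. Cutting \<open>r\<close> down to the domain of the axiom introduces
  the idempotents \<open>u (ginv g)\<close> and \<open>u g\<close>; the first is absorbed by
  \<open>\<beta> g\<close>, the second by \<open>w g h\<close>.\<close>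

lemma \<beta>_comp_w:
  assumes g: "g \<in> carrier G" and h: "h \<in> carrier G" and r: "r \<in> carrier R"
  shows "\<beta> g (\<beta> h r) \<otimes> w g h = w g h \<otimes> \<beta> (g \<star> h) r"
proof -
  let ?T = "unital_ideal_ring R (D g \<cdot> D (g \<star> h)) (u g \<otimes> u (g \<star> h))"
  let ?k = "ginv (g \<star> h)"
  have k: "ginv h \<star> ginv g = ?k" using g h by (simp add: grp.inv_mult_group)
  define v where "v = inv\<^bsub>?T\<^esub> (w g h)"
  \<comment> \<open>The library facts on inverses of units apply to \<open>w g h\<close> only once
    \<open>?T\<close> is known to be a monoid.\<close>
  interpret T: monoid ?T
    by (rule monoidI)
      (use g h in \<open>auto simp: unital_ideal_ring_def D_prod_iff D_r_closed D_carr u_closed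
         u_mult_in_D D_l_closed u_in_D rng.m_assoc D_left D_right
         rng.m_assoc[symmetric, of _ "u g" "u (g \<star> h)"]\<close>)
  have v: "v \<in> carrier R" "v \<otimes> w g h = u g \<otimes> u (g \<star> h)"
    using T.Units_inv_closed[OF w_unit[OF g h]] T.Units_l_inv[OF w_unit[OF g h]] g h
    by (auto simp: v_def unital_ideal_ring_def D_prod_iff D_carr)
  \<comment> \<open>\<open>a\<close> is the part of \<open>r\<close> in the domain of
    \<open>\<alpha>_comp\<close>.\<close>
  define a where "a = u (ginv h) \<otimes> (u ?k \<otimes> r)"
  have a: "a \<in> carrier R" "a \<in> D (ginv h)" "a \<in> D ?k"
    using g h r unfolding a_def
    by (auto intro!: u_mult_in_D D_l_closed rng.m_closed u_closed)
  have "\<beta> h a = u h \<otimes> (u h \<otimes> u (h \<star> ?k) \<otimes> \<beta> h r)"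
    unfolding a_def using g h r by (simp add: \<beta>_mult u_closed \<beta>_u u_one)
  also have "h \<star> ?k = ginv g" using g h by (simp add: grp.inv_mult_group grp.m_assoc[symmetric])
  also have "u h \<otimes> (u h \<otimes> u (ginv g) \<otimes> \<beta> h r) = u (ginv g) \<otimes> \<beta> h r"
    using g h r u_central[of h "u (ginv g)"]
    by (simp add: rng.m_assoc u_closed \<beta>_closed D_left[OF _ \<beta>_in_D] D_left[OF _ D_l_closed] \<beta>_in_D)
  finally have 1: "\<alpha> h a = u (ginv g) \<otimes> \<beta> h r"
    using a h by (simp add: \<beta>_eq_\<alpha>)
  have "\<beta> (g \<star> h) a = u (g \<star> h) \<otimes> u (g \<star> h \<star> ginv h) \<otimes> (u (g \<star> h) \<otimes> \<one> \<otimes> \<beta> (g \<star> h) r)"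
    unfolding a_def using g h r by (simp add: \<beta>_mult u_closed \<beta>_u u_one)
  also have "g \<star> h \<star> ginv h = g" using g h by (simp add: grp.m_assoc)
  also have "u (g \<star> h) \<otimes> u g \<otimes> (u (g \<star> h) \<otimes> \<one> \<otimes> \<beta> (g \<star> h) r) = u g \<otimes> \<beta> (g \<star> h) r"
    using g h r
    by (simp add: rng.m_assoc u_closed \<beta>_closed D_left[OF _ \<beta>_in_D] D_left[OF _ D_l_closed] \<beta>_in_D)
  finally have 2: "\<alpha> (g \<star> h) a = u g \<otimes> \<beta> (g \<star> h) r"
    using a g h by (simp add: \<beta>_eq_\<alpha>)
  have "\<alpha> g (\<alpha> h a) = w g h \<otimes> \<alpha> (g \<star> h) a \<otimes> v"
    unfolding v_def using a g h by (intro \<alpha>_comp) (auto simp: D_prod_iff k)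
  then have "\<beta> g (\<beta> h r) = w g h \<otimes> (u g \<otimes> \<beta> (g \<star> h) r) \<otimes> v"
    by (simp add: 1 2 \<beta>_def[of g])
  then have "\<beta> g (\<beta> h r) \<otimes> w g h = w g h \<otimes> (u g \<otimes> \<beta> (g \<star> h) r) \<otimes> (v \<otimes> w g h)"
    using g h r v by (simp add: rng.m_assoc w_closed u_closed \<beta>_closed)
  also have "\<dots> = w g h \<otimes> (u g \<otimes> \<beta> (g \<star> h) r) \<otimes> (u (g \<star> h) \<otimes> u g)"
    using v g h by (simp add: u_central[of g] u_closed)
  also have "\<dots> = w g h \<otimes> (u g \<otimes> (\<beta> (g \<star> h) r \<otimes> u (g \<star> h) \<otimes> u g))"
    using g h r by (simp add: rng.m_assoc w_closed u_closed \<beta>_closed)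
  also have "\<beta> (g \<star> h) r \<otimes> u (g \<star> h) \<otimes> u g = u g \<otimes> \<beta> (g \<star> h) r"
    using g h r by (simp add: D_right[OF _ \<beta>_in_D] u_central[of g] \<beta>_closed)
  also have "w g h \<otimes> (u g \<otimes> (u g \<otimes> \<beta> (g \<star> h) r)) = (w g h \<otimes> u g) \<otimes> u g \<otimes> \<beta> (g \<star> h) r"
    using g h r by (simp add: rng.m_assoc w_closed u_closed \<beta>_closed)
  also have "\<dots> = w g h \<otimes> \<beta> (g \<star> h) r"
    using g h by (simp add: D_right w_in_D)
  finally show ?thesis .
qed

text \<open>Take the cocycle axiom at the identity \<open>?a\<close> of its domain. On the left,
  \<open>w h t\<close> absorbs \<open>u h\<close> and \<open>u (h \<star> t)\<close>; on the right,
  \<open>\<alpha> g ?a\<close> is a product of idempotents absorbed by \<open>w g h\<close> and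
  \<open>w (g \<star> h) t\<close>.\<close>

lemma w_cocycle':
  assumes g: "g \<in> carrier G" and h: "h \<in> carrier G" and t: "t \<in> carrier G"
  shows "\<beta> g (w h t) \<otimes> w g (h \<star> t) = w g h \<otimes> w (g \<star> h) t"
proof -
  let ?v = "u (ginv g)"
  let ?a = "?v \<otimes> u h \<otimes> u (h \<star> t)"
  have "?a \<in> D (ginv g) \<cdot> D h \<cdot> D (h \<star> t)"
    using assms by (intro ideal_prod.prod u_in_D) auto
  from w_cocycle[OF g h t this]
  have *: "\<alpha> g (?a \<otimes> w h t) \<otimes> w g (h \<star> t) = \<alpha> g ?a \<otimes> w g h \<otimes> w (g \<star> h) t" .
  have "?a \<otimes> w h t = ?v \<otimes> w h t"
    using assms by (simp add: rng.m_assoc u_closed w_closed D_left w_in_D w_in_D')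
  then have 1: "\<alpha> g (?a \<otimes> w h t) = \<beta> g (w h t)" by (simp add: \<beta>_def)
  have "\<alpha> g ?a = \<beta> g (u h \<otimes> u (h \<star> t))"
    using assms by (simp add: \<beta>_def rng.m_assoc u_closed)
  also have "\<dots> = u g \<otimes> u (g \<star> h) \<otimes> (u g \<otimes> u (g \<star> h \<star> t))"
    using assms by (simp add: \<beta>_mult \<beta>_u u_closed grp.m_assoc)
  finally have 2: "\<alpha> g ?a = u g \<otimes> u (g \<star> h) \<otimes> (u g \<otimes> u (g \<star> h \<star> t))" .
  have gh: "g \<star> h \<in> carrier G" and ght: "g \<star> h \<star> t \<in> carrier G" using assms by auto
  have "\<alpha> g ?a \<otimes> w g h \<otimes> w (g \<star> h) t
      = u g \<otimes> (u (g \<star> h) \<otimes> (u g \<otimes> (u (g \<star> h \<star> t) \<otimes> (w g h \<otimes> w (g \<star> h) t))))"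
    unfolding 2 using assms gh ght
    by (simp add: rng.m_assoc u_closed w_closed)
  also have "\<dots> = w g h \<otimes> w (g \<star> h) t"
    using assms gh ght
    by (simp add: D_left[OF _ D_l_closed] D_left[OF _ D_r_closed] w_in_D w_in_D' w_closed)
  finally show ?thesis using * 1 by simp
qed

text \<open>The preimage of \<open>a\<close> lies in \<open>D (ginv g)\<close>, so \<open>b\<close>
  may be replaced by \<open>u (ginv g) \<otimes> b\<close> and \<open>\<alpha> g\<close> distributed
  over the product. This removes \<open>inv_into\<close> from the multiplication of the crossed
  product.\<close>

lemma mult_\<alpha>_inv:
  assumes g: "g \<in> carrier G" and a: "a \<in> D g" and b: "b \<in> carrier R"
  shows "\<alpha> g (inv_into (D (ginv g)) (\<alpha> g) a \<otimes> b) = a \<otimes> \<beta> g b"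
proof -
  let ?x = "inv_into (D (ginv g)) (\<alpha> g) a"
  have im: "\<alpha> g ` D (ginv g) = D g" using \<alpha>_bij[OF g] by (rule bij_betw_imp_surj_on)
  have x: "?x \<in> D (ginv g)" "\<alpha> g ?x = a"
    using a im by (metis inv_into_into, metis f_inv_into_f)
  have "?x \<otimes> b = ?x \<otimes> (u (ginv g) \<otimes> b)"
    using x g b rng.m_assoc[of ?x "u (ginv g)" b] by (simp add: D_right D_carr[of "ginv g"] u_closed)
  then show ?thesis
    using \<alpha>_mult[OF g x(1), of "u (ginv g) \<otimes> b"] g b x by (simp add: \<beta>_def u_mult_in_D)
qed

section \<open>The multiplication of the crossed product as a sum over one index\<close>

abbreviation smult :: "('g \<Rightarrow> 'a) \<Rightarrow> ('g \<Rightarrow> 'a) \<Rightarrow> 'g \<Rightarrow> 'a" (infixl "\<odot>" 70) where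
  "a \<odot> b \<equiv> a \<otimes>\<^bsub>S\<^esub> b"

abbreviation supp :: "('g \<Rightarrow> 'a) \<Rightarrow> 'g set" where "supp a \<equiv> {g. a g \<noteq> \<zero>}"

lemma carrier_S: "a \<in> carrier S \<longleftrightarrow>
    (\<forall>g\<in>carrier G. a g \<in> D g) \<and> (\<forall>g. g \<notin> carrier G \<longrightarrow> a g = \<zero>) \<and> finite (supp a)"
  by (simp add: crossed_product_def)

lemma zero_S: "\<zero>\<^bsub>S\<^esub> = (\<lambda>g. \<zero>)"
  and one_S: "\<one>\<^bsub>S\<^esub> = (\<lambda>g. if g = e then \<one> else \<zero>)"
  and add_S: "a \<oplus>\<^bsub>S\<^esub> b = (\<lambda>g. a g \<oplus> b g)"
  by (simp_all add: crossed_product_def)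

lemma coeff_in_D: "\<lbrakk>a \<in> carrier S; g \<in> carrier G\<rbrakk> \<Longrightarrow> a g \<in> D g"
  and coeff_outside: "\<lbrakk>a \<in> carrier S; g \<notin> carrier G\<rbrakk> \<Longrightarrow> a g = \<zero>"
  and finite_supp: "a \<in> carrier S \<Longrightarrow> finite (supp a)"
  by (auto simp: carrier_S)

lemma supp_subset: "a \<in> carrier S \<Longrightarrow> supp a \<subseteq> carrier G"
  by (auto simp: carrier_S)

lemma coeff_closed: "a \<in> carrier S \<Longrightarrow> a g \<in> carrier R"
  by (cases "g \<in> carrier G") (auto simp: coeff_outside intro: D_carr[OF _ coeff_in_D])

text \<open>The contribution of \<open>g\<close> to the coefficient of a product at
  \<open>k\<close>: the index of the second factor is forced to be \<open>ginv g \<star> k\<close>,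
  so the sum over pairs becomes a sum over \<open>g\<close>.\<close>

definition mult_term :: "('g \<Rightarrow> 'a) \<Rightarrow> ('g \<Rightarrow> 'a) \<Rightarrow> 'g \<Rightarrow> 'g \<Rightarrow> 'a" where
  "mult_term a b k g = a g \<otimes> \<beta> g (b (ginv g \<star> k)) \<otimes> w g (ginv g \<star> k)"

lemma inv_star_cancel: "\<lbrakk>g \<in> carrier G; h \<in> carrier G\<rbrakk> \<Longrightarrow> g \<star> (ginv g \<star> h) = h"
  by (simp add: grp.m_assoc[symmetric])

lemma inv_star_cancel': "\<lbrakk>g \<in> carrier G; h \<in> carrier G\<rbrakk> \<Longrightarrow> ginv g \<star> (g \<star> h) = h"
  by (simp add: grp.m_assoc[symmetric])

lemma star_inv_cancel: "\<lbrakk>g \<in> carrier G; h \<in> carrier G\<rbrakk> \<Longrightarrow> h \<star> g \<star> ginv g = h"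
  by (simp add: grp.m_assoc)

lemma mult_term_in_D:
  assumes "a \<in> carrier S" "b \<in> carrier S" "k \<in> carrier G" "g \<in> carrier G"
  shows "mult_term a b k g \<in> D k"
  unfolding mult_term_def using assms
  by (intro D_l_closed)
    (simp_all add: coeff_closed \<beta>_closed
      w_in_D'[of g "ginv g \<star> k", unfolded inv_star_cancel[OF assms(4,3)]])

lemma mult_term_closed:
  assumes "a \<in> carrier S" "b \<in> carrier S" "k \<in> carrier G" "g \<in> carrier G"
  shows "mult_term a b k g \<in> carrier R"
  using mult_term_in_D[OF assms] assms(3) by (rule D_carr[rotated])

lemma mult_term_zero:
  assumes "b \<in> carrier S" "k \<in> carrier G" "g \<in> carrier G"
    and "a g = \<zero> \<or> b (ginv g \<star> k) = \<zero> \<and> a \<in> carrier S"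
  shows "mult_term a b k g = \<zero>"
  using assms by (auto simp: mult_term_def \<beta>_zero coeff_closed \<beta>_closed w_closed)

text \<open>The pairs in the defining sum are the image under \<open>?j\<close> of the
  \<open>g\<close> with both coefficients nonzero, and all other terms vanish. Leaving
  \<open>F\<close> free allows several products to be summed over a common index set.\<close>

lemma smult_eq:
  assumes a: "a \<in> carrier S" and b: "b \<in> carrier S" and k: "k \<in> carrier G"
    and F: "finite F" "F \<subseteq> carrier G" "supp a \<subseteq> F"
  shows "(a \<odot> b) k = (\<Oplus>g\<in>F. mult_term a b k g)"
proof -
  let ?f = "\<lambda>(g, h). \<alpha> g (inv_into (D (ginv g)) (\<alpha> g) (a g) \<otimes> b h) \<otimes> w g h"
  let ?P = "{(g, h). a g \<noteq> \<zero> \<and> b h \<noteq> \<zero> \<and> g \<star> h = k}"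
  let ?A = "{g \<in> F. a g \<noteq> \<zero> \<and> b (ginv g \<star> k) \<noteq> \<zero>}"
  let ?j = "\<lambda>g. (g, ginv g \<star> k)"
  have f: "?f (?j g) = mult_term a b k g" if "g \<in> carrier G" for g
    using that a b by (simp add: mult_term_def mult_\<alpha>_inv coeff_in_D coeff_closed)
  have "?P = ?j ` ?A"
  proof (intro equalityI subsetI)
    fix p assume "p \<in> ?P"
    then obtain g h where p: "p = (g, h)" "a g \<noteq> \<zero>" "b h \<noteq> \<zero>" "g \<star> h = k" by auto
    then have "g \<in> carrier G" "h \<in> carrier G"
      using coeff_outside[OF a] coeff_outside[OF b] by blast+
    with p have "h = ginv g \<star> k" by (auto simp: inv_star_cancel')
    with p F show "p \<in> ?j ` ?A" by auto
  qed (use k F in \<open>auto simp: inv_star_cancel subset_eq\<close>)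
  then have "(a \<odot> b) k = finsum R ?f (?j ` ?A)"
    by (simp add: crossed_product_def)
  also have "\<dots> = (\<Oplus>g\<in>?A. ?f (?j g))"
    by (rule rng.finsum_reindex)
      (use f a b k F mult_term_closed in \<open>auto simp: inj_on_def Pi_def subset_eq simp del: split_paired_All\<close>)
  also have "\<dots> = (\<Oplus>g\<in>F. mult_term a b k g)"
    by (rule rng.add.finprod_mono_neutral_cong_left)
      (use f a b k F in \<open>auto simp: Pi_def subset_eq mult_term_closed intro!: mult_term_zero\<close>)
  finally show ?thesis .
qed

lemma smult_outside:
  assumes a: "a \<in> carrier S" and b: "b \<in> carrier S" and k: "k \<notin> carrier G"
  shows "(a \<odot> b) k = \<zero>"
proof -
  have *: "{(g, h). a g \<noteq> \<zero> \<and> b h \<noteq> \<zero> \<and> g \<star> h = k} = {}"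
    using a b k coeff_outside by blast
  show ?thesis
    by (simp only: crossed_product_def monoid.select_convs * rng.finsum_empty)
qed

lemma smult_eq_supp:
  assumes "a \<in> carrier S" "b \<in> carrier S" "k \<in> carrier G"
  shows "(a \<odot> b) k = (\<Oplus>g\<in>supp a. mult_term a b k g)"
  using assms by (intro smult_eq finite_supp supp_subset) auto

lemma smult_closed:
  assumes a: "a \<in> carrier S" and b: "b \<in> carrier S"
  shows "a \<odot> b \<in> carrier S"
  unfolding carrier_S
proof (intro conjI ballI allI impI)
  fix k assume k: "k \<in> carrier G"
  show "(a \<odot> b) k \<in> D k"
    unfolding smult_eq_supp[OF a b k]
    by (rule ideal.finsum_mem[OF D_ideal[OF k]])
      (use a b k supp_subset[OF a] in \<open>auto intro!: mult_term_in_D\<close>)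
next
  \<comment> \<open>A nonzero coefficient of the product has a nonzero term, so its index is a
    product of indices from the two finite supports.\<close>
  have "supp (a \<odot> b) \<subseteq> (\<lambda>(g, h). g \<star> h) ` (supp a \<times> supp b)"
  proof
    fix k assume "k \<in> supp (a \<odot> b)"
    then have nz: "(a \<odot> b) k \<noteq> \<zero>" by simp
    then have k: "k \<in> carrier G" using smult_outside[OF a b] by blast
    note nz = nz[unfolded smult_eq_supp[OF a b k]]
    then obtain g where g: "a g \<noteq> \<zero>" "mult_term a b k g \<noteq> \<zero>"
      using rng.add.finprod_one_eqI[of "supp a" "mult_term a b k"] by auto
    then have "g \<in> carrier G" "b (ginv g \<star> k) \<noteq> \<zero>"
      using mult_term_zero[OF b k _, of g a] coeff_outside[OF a] a by blast+
    then show "k \<in> (\<lambda>(g, h). g \<star> h) ` (supp a \<times> supp b)"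
      using g k inv_star_cancel[of g k] by (auto intro!: rev_image_eqI[of "(g, ginv g \<star> k)"])
  qed
  then show "finite (supp (a \<odot> b))"
    by (rule finite_subset) (use a b finite_supp in auto)
qed (rule smult_outside[OF a b])

section \<open>Additive structure and distributivity\<close>

lemma add_closed: "\<lbrakk>a \<in> carrier S; b \<in> carrier S\<rbrakk> \<Longrightarrow> (\<lambda>g. a g \<oplus> b g) \<in> carrier S"
  unfolding carrier_S
  by (auto intro: D_add finite_subset[of "supp (\<lambda>g. a g \<oplus> b g)" "supp a \<union> supp b"])

lemma zero_closed: "(\<lambda>g. \<zero>) \<in> carrier S"
  by (auto simp: carrier_S intro: D_zero)

lemma minus_closed: "a \<in> carrier S \<Longrightarrow> (\<lambda>g. \<ominus> a g) \<in> carrier S"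
  unfolding carrier_S
  by (auto intro: D_minus finite_subset[of "supp (\<lambda>g. \<ominus> a g)" "supp a"])

lemma smult_l_distr:
  assumes a: "a \<in> carrier S" and b: "b \<in> carrier S" and c: "c \<in> carrier S"
  shows "(\<lambda>g. a g \<oplus> b g) \<odot> c = (\<lambda>g. (a \<odot> c) g \<oplus> (b \<odot> c) g)"
proof
  fix k
  \<comment> \<open>A common index set for \<open>a\<close>, \<open>b\<close> and their sum, whose
    support may be smaller through cancellation.\<close>
  let ?F = "supp a \<union> supp b"
  have F: "finite ?F" "?F \<subseteq> carrier G" using a b finite_supp supp_subset by auto
  have ab: "(\<lambda>g. a g \<oplus> b g) \<in> carrier S" by (rule add_closed[OF a b])
  show "((\<lambda>g. a g \<oplus> b g) \<odot> c) k = (a \<odot> c) k \<oplus> (b \<odot> c) k"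
  proof (cases "k \<in> carrier G")
    case k: True
    have "((\<lambda>g. a g \<oplus> b g) \<odot> c) k = (\<Oplus>g\<in>?F. mult_term (\<lambda>g. a g \<oplus> b g) c k g)"
      by (rule smult_eq[OF ab c k F]) auto
    also have "\<dots> = (\<Oplus>g\<in>?F. mult_term a c k g \<oplus> mult_term b c k g)"
      by (rule rng.finsum_cong')
        (use F a b c k in \<open>auto simp: mult_term_closed subset_eq mult_term_def rng.l_distr
           coeff_closed \<beta>_closed w_closed\<close>)
    also have "\<dots> = (\<Oplus>g\<in>?F. mult_term a c k g) \<oplus> (\<Oplus>g\<in>?F. mult_term b c k g)"
      by (rule rng.finsum_addf) (use F a b c k in \<open>auto simp: mult_term_closed subset_eq\<close>)
    also have "\<dots> = (a \<odot> c) k \<oplus> (b \<odot> c) k"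
      using smult_eq[OF a c k F] smult_eq[OF b c k F] by auto
    finally show ?thesis .
  qed (simp add: smult_outside a b c ab)
qed

lemma smult_r_distr:
  assumes a: "a \<in> carrier S" and b: "b \<in> carrier S" and c: "c \<in> carrier S"
  shows "c \<odot> (\<lambda>g. a g \<oplus> b g) = (\<lambda>g. (c \<odot> a) g \<oplus> (c \<odot> b) g)"
proof
  fix k
  have ab: "(\<lambda>g. a g \<oplus> b g) \<in> carrier S" by (rule add_closed[OF a b])
  show "(c \<odot> (\<lambda>g. a g \<oplus> b g)) k = (c \<odot> a) k \<oplus> (c \<odot> b) k"
  proof (cases "k \<in> carrier G")
    case k: True
    have "(\<Oplus>g\<in>supp c. mult_term c (\<lambda>g. a g \<oplus> b g) k g)
        = (\<Oplus>g\<in>supp c. mult_term c a k g \<oplus> mult_term c b k g)"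
      by (rule rng.finsum_cong')
        (use supp_subset[OF c] a b c k in \<open>auto simp: mult_term_closed subset_eq mult_term_def
           rng.l_distr rng.r_distr \<beta>_add coeff_closed \<beta>_closed w_closed\<close>)
    also have "\<dots> = (\<Oplus>g\<in>supp c. mult_term c a k g) \<oplus> (\<Oplus>g\<in>supp c. mult_term c b k g)"
      by (rule rng.finsum_addf)
        (use supp_subset[OF c] a b c k in \<open>auto simp: mult_term_closed subset_eq\<close>)
    finally show ?thesis by (simp add: smult_eq_supp a b c ab k)
  qed (simp add: smult_outside a b c ab)
qed

section \<open>Monomials and the ring axioms\<close>

definition monomial :: "'g \<Rightarrow> 'a \<Rightarrow> 'g \<Rightarrow> 'a" where
  "monomial g a = (\<lambda>k. if k = g then a else \<zero>)"

lemma monomial_closed: "\<lbrakk>g \<in> carrier G; a \<in> D g\<rbrakk> \<Longrightarrow> monomial g a \<in> carrier S"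
  by (auto simp: carrier_S monomial_def D_zero)

lemma one_eq_monomial: "\<one>\<^bsub>S\<^esub> = monomial e \<one>"
  by (simp add: one_S monomial_def)

text \<open>Monomials generate the crossed product additively: the induction on the finite support
  splits off one coefficient at a time. It serves for associativity and for centrality, both
  additive conditions.\<close>

lemma crossed_induct [consumes 1, case_names zero add]:
  assumes a: "a \<in> carrier S"
    and zero: "P (\<lambda>g. \<zero>)"
    and add: "\<And>g r b. \<lbrakk>g \<in> carrier G; r \<in> D g; b \<in> carrier S; P b\<rbrakk> \<Longrightarrow> P (\<lambda>k. monomial g r k \<oplus> b k)"
  shows "P a"
proof -
  have "P a" if "finite F" "a \<in> carrier S" "supp a = F" for F a
    using that
  proof (induction F arbitrary: a rule: finite_induct)
    case empty
    then have "a = (\<lambda>g. \<zero>)" by auto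
    then show ?case using zero by simp
  next
    case (insert g F)
    have g: "g \<in> carrier G" using insert.prems supp_subset by blast
    let ?b = "a(g := \<zero>)"
    have supp: "supp ?b = F" using insert by auto
    have b: "?b \<in> carrier S"
      unfolding carrier_S supp using insert.prems insert.hyps
      by (auto simp: carrier_S D_zero)
    have "P (\<lambda>k. monomial g (a g) k \<oplus> ?b k)"
      by (rule add[OF g coeff_in_D[OF insert.prems(1) g] b insert.IH[OF b supp]])
    also have "(\<lambda>k. monomial g (a g) k \<oplus> ?b k) = a"
      using insert.prems by (auto simp: monomial_def coeff_closed)
    finally show ?case .
  qed
  from this[OF finite_supp[OF a] a refl] show ?thesis .
qed

lemma monomial_smult:
  assumes g: "g \<in> carrier G" and r: "r \<in> D g" and b: "b \<in> carrier S" and k: "k \<in> carrier G"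
  shows "(monomial g r \<odot> b) k = r \<otimes> \<beta> g (b (ginv g \<star> k)) \<otimes> w g (ginv g \<star> k)"
proof -
  have "(monomial g r \<odot> b) k = (\<Oplus>x\<in>{g}. mult_term (monomial g r) b k x)"
    by (rule smult_eq[OF monomial_closed[OF g r] b k]) (use g in \<open>auto simp: monomial_def\<close>)
  also have "\<dots> = mult_term (monomial g r) b k g"
    using mult_term_closed[OF monomial_closed[OF g r] b k g] by simp
  finally show ?thesis by (simp add: mult_term_def monomial_def)
qed

lemma smult_monomial:
  assumes h: "h \<in> carrier G" and r: "r \<in> D h" and b: "b \<in> carrier S" and k: "k \<in> carrier G"
  shows "(b \<odot> monomial h r) k = b (k \<star> ginv h) \<otimes> \<beta> (k \<star> ginv h) r \<otimes> w (k \<star> ginv h) h"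
proof -
  let ?g = "k \<star> ginv h"
  \<comment> \<open>The surviving index \<open>?g\<close> may lie outside the support of
    \<open>b\<close>, in which case its term is zero; inserting it lets the sum collapse to
    \<open>{?g}\<close>.\<close>
  let ?F = "insert ?g (supp b)"
  have F: "finite ?F" "?F \<subseteq> carrier G" using h k b finite_supp supp_subset by auto
  have m: "monomial h r \<in> carrier S" by (rule monomial_closed[OF h r])
  have gh: "ginv ?g \<star> k = h" using h k
    by (simp add: grp.inv_mult_group grp.m_assoc)
  have ne: "ginv g \<star> k \<noteq> h" if "g \<in> carrier G" "g \<noteq> ?g" for g
    using that h k by (metis inv_star_cancel star_inv_cancel)
  have "(b \<odot> monomial h r) k = (\<Oplus>g\<in>?F. mult_term b (monomial h r) k g)"
    by (rule smult_eq[OF b m k F]) auto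
  also have "\<dots> = (\<Oplus>g\<in>{?g}. mult_term b (monomial h r) k g)"
    by (rule rng.add.finprod_mono_neutral_cong_right)
      (use F ne m b k in \<open>auto simp: monomial_def Pi_def subset_eq mult_term_closed intro!: mult_term_zero\<close>)
  also have "\<dots> = mult_term b (monomial h r) k ?g"
    using mult_term_closed[OF b m k, of ?g] h k by simp
  finally show ?thesis using gh by (simp add: mult_term_def monomial_def)
qed

lemma monomial_smult_monomial:
  assumes g: "g \<in> carrier G" and r: "r \<in> D g" and h: "h \<in> carrier G" and s: "s \<in> D h"
  shows "monomial g r \<odot> monomial h s = monomial (g \<star> h) (r \<otimes> \<beta> g s \<otimes> w g h)"
proof
  fix k
  have m: "monomial g r \<in> carrier S" "monomial h s \<in> carrier S" using assms by (auto intro: monomial_closed)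
  show "(monomial g r \<odot> monomial h s) k = monomial (g \<star> h) (r \<otimes> \<beta> g s \<otimes> w g h) k"
  proof (cases "k \<in> carrier G")
    case k: True
    have "ginv g \<star> k = h \<longleftrightarrow> k = g \<star> h"
      using g h k by (metis inv_star_cancel inv_star_cancel')
    then show ?thesis
      unfolding monomial_smult[OF g r m(2) k]
      using g h r k by (auto simp: monomial_def inv_star_cancel' \<beta>_zero D_carr w_closed)
  next
    case False
    with g h have "k \<noteq> g \<star> h" by auto
    with False show ?thesis by (simp add: smult_outside m monomial_def[of "g \<star> h"])
  qed
qed

lemma zero_smult: "a \<in> carrier S \<Longrightarrow> (\<lambda>g. \<zero>) \<odot> a = (\<lambda>g. \<zero>)"
  by (auto simp: crossed_product_def)

lemma smult_zero: "a \<in> carrier S \<Longrightarrow> a \<odot> (\<lambda>g. \<zero>) = (\<lambda>g. \<zero>)"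
  by (auto simp: crossed_product_def)

text \<open>With the brackets to the left, \<open>\<beta>_comp_w\<close> moves \<open>w g h\<close>
  past the coefficient \<open>q\<close>, and then \<open>w_cocycle'\<close> turns the two twists
  into those of the other bracketing.\<close>

lemma monomial_assoc:
  assumes g: "g \<in> carrier G" "r \<in> D g" and h: "h \<in> carrier G" "s \<in> D h"
    and t: "t \<in> carrier G" "q \<in> D t"
  shows "monomial g r \<odot> monomial h s \<odot> monomial t q = monomial g r \<odot> (monomial h s \<odot> monomial t q)"
proof -
  note cl = D_carr[OF g] D_carr[OF h] D_carr[OF t] \<beta>_closed w_closed
  have in1: "r \<otimes> \<beta> g s \<otimes> w g h \<in> D (g \<star> h)" and in2: "s \<otimes> \<beta> h q \<otimes> w h t \<in> D (h \<star> t)"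
    using g h t by (auto intro!: D_l_closed w_in_D' \<beta>_closed simp: cl)
  have "r \<otimes> \<beta> g s \<otimes> w g h \<otimes> \<beta> (g \<star> h) q \<otimes> w (g \<star> h) t
      = r \<otimes> \<beta> g s \<otimes> (w g h \<otimes> \<beta> (g \<star> h) q) \<otimes> w (g \<star> h) t"
    using g h t by (simp add: rng.m_assoc cl)
  also have "\<dots> = r \<otimes> \<beta> g s \<otimes> (\<beta> g (\<beta> h q) \<otimes> w g h) \<otimes> w (g \<star> h) t"
    using g h t by (simp add: \<beta>_comp_w cl)
  also have "\<dots> = r \<otimes> \<beta> g s \<otimes> \<beta> g (\<beta> h q) \<otimes> (w g h \<otimes> w (g \<star> h) t)"
    using g h t by (simp add: rng.m_assoc cl)
  also have "\<dots> = r \<otimes> \<beta> g s \<otimes> \<beta> g (\<beta> h q) \<otimes> (\<beta> g (w h t) \<otimes> w g (h \<star> t))"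
    using g h t by (simp add: w_cocycle')
  also have "\<dots> = r \<otimes> \<beta> g (s \<otimes> \<beta> h q \<otimes> w h t) \<otimes> w g (h \<star> t)"
    using g h t by (simp add: rng.m_assoc \<beta>_mult cl)
  finally show ?thesis
    using g h t in1 in2 by (simp add: monomial_smult_monomial grp.m_assoc)
qed

text \<open>Both sides are additive in each factor, so three inductions, on the last factor, then
  the middle one, then the first, reduce the claim to monomials.\<close>

lemma smult_assoc:
  assumes a: "a \<in> carrier S" and b: "b \<in> carrier S" and c: "c \<in> carrier S"
  shows "a \<odot> b \<odot> c = a \<odot> (b \<odot> c)"
proof -
  note cl = monomial_closed smult_closed smult_l_distr smult_r_distr zero_smult smult_zero zero_closed
  have 1: "monomial g r \<odot> monomial h s \<odot> c = monomial g r \<odot> (monomial h s \<odot> c)"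
    if "g \<in> carrier G" "r \<in> D g" "h \<in> carrier G" "s \<in> D h" for g r h s
    using c by (induction c rule: crossed_induct) (use that in \<open>simp_all add: cl monomial_assoc\<close>)
  have 2: "monomial g r \<odot> b \<odot> c = monomial g r \<odot> (b \<odot> c)"
    if "g \<in> carrier G" "r \<in> D g" for g r
    using b by (induction b rule: crossed_induct) (use that c in \<open>simp_all add: cl 1\<close>)
  show ?thesis
    using a by (induction a rule: crossed_induct) (use b c in \<open>simp_all add: cl 2\<close>)
qed

lemma base_smult:
  assumes r: "r \<in> carrier R" and b: "b \<in> carrier S" and k: "k \<in> carrier G"
  shows "(monomial e r \<odot> b) k = r \<otimes> b k"
  using assms D_one
  by (simp add: monomial_smult \<beta>_one coeff_closed w_one_left rng.m_assoc u_closed D_right coeff_in_D)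

lemma smult_base:
  assumes r: "r \<in> carrier R" and b: "b \<in> carrier S" and k: "k \<in> carrier G"
  shows "(b \<odot> monomial e r) k = b k \<otimes> \<beta> k r"
  using assms D_one
  by (simp add: smult_monomial coeff_closed w_one_right rng.m_assoc u_closed \<beta>_closed
      D_right[OF _ \<beta>_in_D])

lemma supp_base_smult:
  assumes r: "r \<in> carrier R" and b: "b \<in> carrier S"
  shows "supp (monomial e r \<odot> b) \<subseteq> supp b"
proof (rule subsetI, rule ccontr)
  have m: "monomial e r \<in> carrier S" using r by (intro monomial_closed) (auto simp: D_one)
  fix k assume k: "k \<in> supp (monomial e r \<odot> b)" "k \<notin> supp b"
  then have "k \<in> carrier G" using supp_subset[OF smult_closed[OF m b]] by blast
  with k show False using r by (simp add: base_smult[OF r b])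
qed

lemma supp_smult_base:
  assumes r: "r \<in> carrier R" and b: "b \<in> carrier S"
  shows "supp (b \<odot> monomial e r) \<subseteq> supp b"
proof (rule subsetI, rule ccontr)
  have m: "monomial e r \<in> carrier S" using r by (intro monomial_closed) (auto simp: D_one)
  fix k assume k: "k \<in> supp (b \<odot> monomial e r)" "k \<notin> supp b"
  then have "k \<in> carrier G" using supp_subset[OF smult_closed[OF b m]] by blast
  with k show False using r by (simp add: smult_base[OF r b] \<beta>_closed)
qed

lemma one_closed: "\<one>\<^bsub>S\<^esub> \<in> carrier S"
  unfolding one_eq_monomial by (rule monomial_closed) (simp_all add: D_one)

lemma ring_S: "ring S"
proof (rule ringI)
  show "abelian_group S"
  proof (rule abelian_groupI, unfold add_S zero_S)
    fix a assume a: "a \<in> carrier S"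
    show "\<exists>b\<in>carrier S. (\<lambda>g. b g \<oplus> a g) = (\<lambda>g. \<zero>)"
      using a by (intro bexI[of _ "\<lambda>g. \<ominus> a g"] minus_closed)
        (auto simp: coeff_closed rng.l_neg)
  qed (auto simp: add_closed zero_closed coeff_closed rng.a_ac)
next
  show "monoid S"
  proof (rule monoidI)
    fix a assume a: "a \<in> carrier S"
    note one = one_closed[unfolded one_eq_monomial]
    \<comment> \<open>On the right the coefficient at \<open>g\<close> gets multiplied by
      \<open>\<beta> g \<one> = u g\<close>, the identity of \<open>D g\<close>.\<close>
    show "\<one>\<^bsub>S\<^esub> \<odot> a = a" "a \<odot> \<one>\<^bsub>S\<^esub> = a"
      unfolding one_eq_monomial fun_eq_iff
      using a base_smult[OF rng.one_closed a] smult_base[OF rng.one_closed a]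
        smult_outside[OF a one] smult_outside[OF one a] coeff_outside[OF a] coeff_in_D[OF a]
      by (metis \<beta>_unit D_right D_carr rng.l_one)+
  qed (auto simp: smult_closed one_closed smult_assoc)
qed (simp_all add: add_S smult_l_distr smult_r_distr)

lemma minus_S:
  assumes a: "a \<in> carrier S" shows "\<ominus>\<^bsub>S\<^esub> a = (\<lambda>g. \<ominus> a g)"
proof -
  interpret S: ring S by (rule ring_S)
  show ?thesis
    by (rule S.minus_equality) (use a in \<open>auto simp: add_S zero_S minus_closed coeff_closed rng.l_neg\<close>)
qed

section \<open>Invariant ideals of \<open>R\<close> and ideals of the crossed product\<close>

lemma invariant_ideal_\<beta>:
  assumes I: "invariant_ideal G R D \<alpha> I" and g: "g \<in> carrier G" and r: "r \<in> I"
  shows "\<beta> g r \<in> I"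
proof -
  interpret I: ideal I R using I by (simp add: invariant_ideal_def)
  have "u (ginv g) \<otimes> r \<in> I \<inter> D (ginv g)"
    using g r by (auto intro!: I.I_l_closed u_mult_in_D u_closed)
  then show ?thesis using I g by (auto simp: invariant_ideal_def \<beta>_def)
qed

text \<open>Each coefficient of a product is a sum of \<open>mult_term\<close>s. If the left factor
  has coefficients in \<open>I\<close>, every term is a right multiple of one of them; if the right
  factor does, they occur under \<open>\<beta> g\<close>, which preserves \<open>I\<close> by
  invariance.\<close>

lemma ideal_of_invariant_ideal:
  assumes I: "invariant_ideal G R D \<alpha> I"
  shows "ideal {a \<in> carrier S. \<forall>g. a g \<in> I} S" (is "ideal ?J S")
proof -
  interpret S: ring S by (rule ring_S)
  interpret I: ideal I R using I by (simp add: invariant_ideal_def)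
  note I_add = additive_subgroup.a_closed[OF I.additive_subgroup_axioms]
  show ?thesis
  proof (rule idealI[OF ring_S])
    show "subgroup ?J (add_monoid S)"
    proof (rule S.add.subgroupI)
      fix a assume a: "a \<in> ?J"
      then show "\<ominus>\<^bsub>S\<^esub> a \<in> ?J" by (auto simp: minus_S minus_closed)
      fix b assume "b \<in> ?J"
      with a show "a \<oplus>\<^bsub>S\<^esub> b \<in> ?J" by (auto simp: add_S add_closed I_add)
    qed (use zero_closed in auto)
  next
    have mem: "(a \<odot> b) k \<in> I"
      if a: "a \<in> carrier S" and b: "b \<in> carrier S" and ab: "(\<forall>g. a g \<in> I) \<or> (\<forall>g. b g \<in> I)" for a b k
    proof (cases "k \<in> carrier G")
      case k: True
      show ?thesis
        unfolding smult_eq_supp[OF a b k]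
      proof (rule I.finsum_mem)
        fix g assume "g \<in> supp a"
        then have g: "g \<in> carrier G" using supp_subset[OF a] by auto
        show "mult_term a b k g \<in> I"
          unfolding mult_term_def using ab
        proof
          assume "\<forall>g. a g \<in> I"
          then show "a g \<otimes> \<beta> g (b (ginv g \<star> k)) \<otimes> w g (ginv g \<star> k) \<in> I"
            using g k b by (intro I.I_r_closed) (simp_all add: \<beta>_closed w_closed coeff_closed)
        next
          assume "\<forall>g. b g \<in> I"
          then show "a g \<otimes> \<beta> g (b (ginv g \<star> k)) \<otimes> w g (ginv g \<star> k) \<in> I"
            using g k a invariant_ideal_\<beta>[OF I g]
            by (intro I.I_r_closed I.I_l_closed) (auto simp: w_closed coeff_closed)
        qed
      qed
    qed (simp add: smult_outside[OF a b])
    fix a x assume "a \<in> ?J" "x \<in> carrier S"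
    then show "x \<odot> a \<in> ?J" "a \<odot> x \<in> ?J" by (auto simp: smult_closed intro!: mem)
  qed
qed

text \<open>The ideal \<open>?J\<close> determines \<open>I\<close>: it contains
  \<open>monomial e r\<close> for every \<open>r\<close> in \<open>I\<close>, so \<open>I\<close>
  vanishes with \<open>?J\<close>; and if \<open>?J\<close> contains the identity, then the
  coefficient \<open>\<one>\<close> at \<open>e\<close> lies in \<open>I\<close>.\<close>

lemma simple_imp_alpha_simple:
  assumes "simple_ring S"
  shows "alpha_simple G R D \<alpha>"
  unfolding alpha_simple_def
proof (intro allI impI)
  fix I assume I: "invariant_ideal G R D \<alpha> I"
  interpret I: ideal I R using I by (simp add: invariant_ideal_def)
  let ?J = "{a \<in> carrier S. \<forall>g. a g \<in> I}"
  have "?J = {\<zero>\<^bsub>S\<^esub>} \<or> ?J = carrier S"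
    using simple_ring.ideal_trivial[OF assms ideal_of_invariant_ideal[OF I]] .
  then show "I = {\<zero>} \<or> I = carrier R"
  proof
    assume J: "?J = {\<zero>\<^bsub>S\<^esub>}"
    have "r = \<zero>" if r: "r \<in> I" for r
    proof -
      have "monomial e r \<in> ?J"
        using r by (auto simp: D_one I.Icarr intro!: monomial_closed) (simp add: monomial_def)
      then show ?thesis unfolding J by (auto simp: zero_S monomial_def dest: fun_cong[of _ _ e])
    qed
    then show ?thesis using I.zero_closed by blast
  next
    assume "?J = carrier S"
    then have "\<one>\<^bsub>S\<^esub> \<in> ?J" using one_closed by simp
    then have "\<one> \<in> I" by (auto simp: one_S dest: spec[of _ e])
    then show ?thesis using I.one_imp_carrier by simp
  qed
qed

text \<open>Every \<open>monomial g r\<close> factors as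
  \<open>monomial e r \<odot> monomial g (u g)\<close>, so it is enough to test centrality on these
  two kinds of factors.\<close>

lemma commutes_with_allI:
  assumes y: "y \<in> carrier S"
    and base: "\<And>r. r \<in> carrier R \<Longrightarrow> monomial e r \<odot> y = y \<odot> monomial e r"
    and grp: "\<And>g. g \<in> carrier G \<Longrightarrow> monomial g (u g) \<odot> y = y \<odot> monomial g (u g)"
    and x: "x \<in> carrier S"
  shows "y \<odot> x = x \<odot> y"
  using x
proof (induction x rule: crossed_induct)
  case zero
  show ?case using y by (simp add: zero_smult smult_zero)
next
  case (add g r b)
  have r: "r \<in> carrier R" using add D_carr by blast
  have m: "monomial e r \<in> carrier S" "monomial g (u g) \<in> carrier S" "monomial g r \<in> carrier S"
    using add r by (auto intro!: monomial_closed u_in_D simp: D_one)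
  have split: "monomial g r = monomial e r \<odot> monomial g (u g)"
    using add r by (simp add: monomial_smult_monomial D_one u_in_D \<beta>_one u_closed w_one_left
        D_right rng.m_assoc u_idem)
  have "y \<odot> monomial g r = y \<odot> monomial e r \<odot> monomial g (u g)"
    using y m by (simp add: split smult_assoc)
  also have "\<dots> = monomial e r \<odot> (y \<odot> monomial g (u g))"
    using y m base[OF r] by (metis smult_assoc)
  also have "\<dots> = monomial g r \<odot> y"
    using y m grp[OF add(1)] by (simp add: split smult_assoc)
  finally show ?case
    using y m add by (simp add: smult_l_distr smult_r_distr)
qed

end

section \<open>Abelian groups: minimal supports and central elements\<close>

locale abelian_crossed_system = crossed_system G R D u \<alpha> w
  for G :: "('g, 'n) monoid_scheme"
    and R :: "('a, 'm) ring_scheme" (structure)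
    and D :: "'g \<Rightarrow> 'a set"
    and u :: "'g \<Rightarrow> 'a"
    and \<alpha> :: "'g \<Rightarrow> 'a \<Rightarrow> 'a"
    and w :: "'g \<Rightarrow> 'g \<Rightarrow> 'a" +
  assumes comm: "\<lbrakk>g \<in> carrier G; h \<in> carrier G\<rbrakk> \<Longrightarrow> g \<star> h = h \<star> g"
begin

text \<open>The bound \<open>F\<close> makes it possible to prescribe the coefficient at
  \<open>e\<close> without leaving a given minimal support.\<close>

definition coeff_ideal :: "('g \<Rightarrow> 'a) set \<Rightarrow> 'g set \<Rightarrow> 'a set" where
  "coeff_ideal J F = {y e |y. y \<in> J \<and> supp y \<subseteq> F}"

lemma coeff_idealI: "\<lbrakk>y \<in> J; supp y \<subseteq> F; y e = r\<rbrakk> \<Longrightarrow> r \<in> coeff_ideal J F"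
  by (auto simp: coeff_ideal_def)

lemma conj_monomial:
  assumes g: "g \<in> carrier G" and y: "y \<in> carrier S" and k: "k \<in> carrier G"
  shows "(monomial g (u g) \<odot> y \<odot> monomial (ginv g) (u (ginv g))) k
    = \<beta> g (y k) \<otimes> w g k \<otimes> \<beta> (k \<star> g) (u (ginv g)) \<otimes> w (k \<star> g) (ginv g)"
proof -
  have m: "monomial g (u g) \<in> carrier S" by (intro monomial_closed u_in_D g)
  \<comment> \<open>Commutativity enters here: the coefficient at \<open>k\<close> of the conjugate
    involves \<open>y k\<close> and no other coefficient of \<open>y\<close>.\<close>
  have "ginv g \<star> (k \<star> g) = k" using g k comm[of k g] by (simp add: inv_star_cancel')
  then show ?thesis
    using g k y m by (simp add: smult_monomial u_in_D smult_closed monomial_smult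
        D_left[OF _ \<beta>_in_D] coeff_closed)
qed

text \<open>As \<open>G\<close> is abelian, conjugation by \<open>u\<^sub>g \<delta>\<^sub>g\<close> does not move supports; on the
  coefficient at the identity it acts as \<open>\<beta> g\<close> up to an invertible twist.\<close>

lemma coeff_ideal_invariant:
  assumes J: "ideal J S"
  shows "invariant_ideal G R D \<alpha> (coeff_ideal J F)"
proof -
  interpret S: ring S by (rule ring_S)
  interpret J: ideal J S by (rule J)
  let ?I = "coeff_ideal J F"
  have e: "e \<in> carrier G" by simp
  have IS: "?I \<subseteq> carrier R"
    by (auto simp: coeff_ideal_def intro: coeff_closed[OF J.Icarr])
  have I: "ideal ?I R"
  proof (rule idealI[OF rng.ring_axioms])
    show "subgroup ?I (add_monoid R)"
    proof (rule rng.add.subgroupI)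
      show "?I \<noteq> {}" using J.zero_closed by (auto simp: coeff_ideal_def zero_S)
    next
      fix a assume "a \<in> ?I"
      then obtain y where y: "y \<in> J" "supp y \<subseteq> F" "a = y e" by (auto simp: coeff_ideal_def)
      then show "\<ominus> a \<in> ?I"
        using J.a_inv_closed[of y] minus_S[OF J.Icarr, of y]
        by (auto simp: coeff_ideal_def intro!: exI[of _ "\<ominus>\<^bsub>S\<^esub> y"])
      fix b assume "b \<in> ?I"
      then obtain z where z: "z \<in> J" "supp z \<subseteq> F" "b = z e" by (auto simp: coeff_ideal_def)
      have "y \<oplus>\<^bsub>S\<^esub> z \<in> J"
        using y z by (intro additive_subgroup.a_closed[OF J.additive_subgroup_axioms])
      moreover have "supp (y \<oplus>\<^bsub>S\<^esub> z) \<subseteq> F"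
      proof (rule subsetI, rule ccontr)
        fix k assume k: "k \<in> supp (y \<oplus>\<^bsub>S\<^esub> z)" "k \<notin> F"
        then have "y k = \<zero>" "z k = \<zero>" using y z by auto
        with k show False by (simp add: add_S)
      qed
      moreover have "(y \<oplus>\<^bsub>S\<^esub> z) e = a \<oplus> b" using y z by (simp add: add_S)
      ultimately show "a \<oplus> b \<in> ?I" by (intro coeff_idealI)
    qed (use IS in auto)
  next
    fix a x assume "a \<in> ?I" and x: "x \<in> carrier R"
    then obtain y where y: "y \<in> J" "supp y \<subseteq> F" "a = y e" by (auto simp: coeff_ideal_def)
    have yS: "y \<in> carrier S" by (rule J.Icarr[OF y(1)])
    have m: "monomial e x \<in> carrier S" using x by (intro monomial_closed) (auto simp: D_one)
    have "supp (monomial e x \<odot> y) \<subseteq> F"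
      using supp_base_smult[OF x yS] y(2) by blast
    moreover have "(monomial e x \<odot> y) e = x \<otimes> a" using base_smult[OF x yS e] y by simp
    moreover have "monomial e x \<odot> y \<in> J" by (rule J.I_l_closed[OF y(1) m])
    ultimately show "x \<otimes> a \<in> ?I" by (intro coeff_idealI)
    have "supp (y \<odot> monomial e x) \<subseteq> F"
      using supp_smult_base[OF x yS] y(2) by blast
    moreover have "(y \<odot> monomial e x) e = a \<otimes> x" using smult_base[OF x yS e] y x by (simp add: \<beta>_one)
    moreover have "y \<odot> monomial e x \<in> J" by (rule J.I_r_closed[OF y(1) m])
    ultimately show "a \<otimes> x \<in> ?I" by (intro coeff_idealI)
  qed
  have "\<alpha> g r \<in> ?I" if g: "g \<in> carrier G" and r: "r \<in> ?I" "r \<in> D (ginv g)" for g r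
  proof -
    obtain y where y: "y \<in> J" "supp y \<subseteq> F" "r = y e" using r(1) by (auto simp: coeff_ideal_def)
    have yS: "y \<in> carrier S" by (rule J.Icarr[OF y(1)])
    have rR: "r \<in> carrier R" using r(1) IS by auto
    have g': "ginv g \<in> carrier G" using g by simp
    \<comment> \<open>The conjugate \<open>?z\<close> will have coefficient
      \<open>\<alpha> g r \<otimes> w g (ginv g)\<close> at \<open>e\<close>. Multiplication by
      \<open>v\<close> removes the twist and stays inside the ideal \<open>?I\<close>.\<close>
    obtain v where v: "v \<in> carrier R" "w g (ginv g) \<otimes> v = u g \<otimes> u (g \<star> ginv g)"
      using w_invertible[OF g g'] by blast
    let ?z = "monomial g (u g) \<odot> y \<odot> monomial (ginv g) (u (ginv g))"
    have m: "monomial g (u g) \<in> carrier S" "monomial (ginv g) (u (ginv g)) \<in> carrier S"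
      using g by (auto intro!: monomial_closed u_in_D)
    have z: "?z \<in> J" by (intro J.I_r_closed J.I_l_closed y m)
    have zS: "?z \<in> carrier S" by (rule J.Icarr[OF z])
    have zF: "supp ?z \<subseteq> F"
    proof
      fix k assume k: "k \<in> supp ?z"
      then have kG: "k \<in> carrier G" using supp_subset[OF zS] by blast
      then have "y k \<noteq> \<zero>"
        using k conj_monomial[OF g yS kG] g by (auto simp: \<beta>_zero w_closed \<beta>_closed u_closed)
      then show "k \<in> F" using y(2) by auto
    qed
    have "?z e = \<beta> g (y e) \<otimes> u g \<otimes> (u g \<otimes> \<one>) \<otimes> w g (ginv g)"
      using conj_monomial[OF g yS e] g by (simp add: w_one_right \<beta>_u u_one)
    also have "\<dots> = \<beta> g r \<otimes> w g (ginv g)"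
      using g rR y(3)[symmetric] by (simp add: D_right[OF g \<beta>_in_D[OF g]] u_closed)
    finally have "?z e \<otimes> v = \<beta> g r \<otimes> (w g (ginv g) \<otimes> v)"
      using v(1) g rR by (simp add: rng.m_assoc \<beta>_closed w_closed)
    also have "\<dots> = \<beta> g r"
      using g rR by (simp add: v(2) u_one u_closed D_right[OF g \<beta>_in_D[OF g]])
    finally have ze: "?z e \<otimes> v = \<beta> g r" .
    have "?z e \<in> ?I" by (rule coeff_idealI[OF z zF refl])
    then have "?z e \<otimes> v \<in> ?I" by (rule ideal.I_r_closed[OF I _ v(1)])
    then show ?thesis using ze \<beta>_eq_\<alpha>[OF g r(2)] by simp
  qed
  then show ?thesis
    using I by (auto simp: invariant_ideal_def intro!: \<alpha>_in)
qed

text \<open>Right multiplication by \<open>u\<^sub>h \<delta>\<^sub>h\<close> with \<open>h = g\<^sup>-\<^sup>1\<close> moves a nonzero coefficient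
  from \<open>g\<close> to the identity without enlarging the support.\<close>

lemma ideal_minimal_support:
  assumes J: "ideal J S" and ne: "J \<noteq> {\<zero>\<^bsub>S\<^esub>}"
  obtains x where "x \<in> J" "x e \<noteq> \<zero>"
    and "\<And>z. \<lbrakk>z \<in> J; card (supp z) < card (supp x)\<rbrakk> \<Longrightarrow> z = \<zero>\<^bsub>S\<^esub>"
proof -
  interpret S: ring S by (rule ring_S)
  interpret J: ideal J S by (rule J)
  let ?P = "\<lambda>x. x \<in> J \<and> x \<noteq> \<zero>\<^bsub>S\<^esub>"
  have "\<exists>x. ?P x" using ne J.zero_closed by blast
  \<comment> \<open>A nonzero element with fewest nonzero coefficients; as \<open>e\<close> may be
    missing from its support, it is translated to \<open>?y\<close>.\<close>
  then obtain x where x: "?P x" and min: "\<And>z. ?P z \<Longrightarrow> card (supp x) \<le> card (supp z)"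
    using ex_has_least_nat[of ?P _ "\<lambda>x. card (supp x)"] by blast
  have xS: "x \<in> carrier S" using x J.Icarr by blast
  from x obtain g where xg: "x g \<noteq> \<zero>" by (auto simp: zero_S)
  have g: "g \<in> carrier G" using xg supp_subset[OF xS] by auto
  let ?m = "monomial (ginv g) (u (ginv g))"
  have m: "?m \<in> carrier S" using g by (auto intro!: monomial_closed u_in_D)
  let ?y = "x \<odot> ?m"
  have y: "?y \<in> J" using x m by (auto intro: J.I_r_closed)
  have yk: "?y k = x (k \<star> g) \<otimes> \<beta> (k \<star> g) (u (ginv g)) \<otimes> w (k \<star> g) (ginv g)" if "k \<in> carrier G" for k
    using that g xS by (simp add: smult_monomial u_in_D)
  have "?y e = x g \<otimes> w g (ginv g)"
    using yk[of e] g xS by (simp add: \<beta>_u u_one u_closed D_right coeff_in_D)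
  \<comment> \<open>The twist has a right inverse up to \<open>u g\<close>, and \<open>u g\<close>
    fixes \<open>x g\<close>, so \<open>x g\<close> can be recovered from this product.\<close>
  moreover have "x g \<otimes> w g (ginv g) \<noteq> \<zero>"
  proof
    assume 0: "x g \<otimes> w g (ginv g) = \<zero>"
    have g': "ginv g \<in> carrier G" using g by simp
    obtain v where v: "v \<in> carrier R" "w g (ginv g) \<otimes> v = u g \<otimes> u (g \<star> ginv g)"
      using w_invertible[OF g g'] by blast
    have "x g = x g \<otimes> (w g (ginv g) \<otimes> v)"
      using v g xS by (simp add: u_one u_closed D_right coeff_in_D)
    also have "\<dots> = \<zero>"
      using v(1) g xS 0 by (simp add: rng.m_assoc[symmetric] w_closed coeff_closed)
    finally show False using xg by simp
  qed
  ultimately have ye: "?y e \<noteq> \<zero>" by simp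
  have "supp ?y \<subseteq> (\<lambda>k. k \<star> ginv g) ` supp x"
  proof
    fix k assume k: "k \<in> supp ?y"
    then have kG: "k \<in> carrier G" using supp_subset[OF J.Icarr[OF y]] by blast
    then have "x (k \<star> g) \<noteq> \<zero>" using k yk[OF kG] g by (auto simp: \<beta>_closed u_closed w_closed)
    moreover have "k = k \<star> g \<star> ginv g" using kG g by (simp add: star_inv_cancel)
    ultimately show "k \<in> (\<lambda>k. k \<star> ginv g) ` supp x" by blast
  qed
  \<comment> \<open>This bound transfers minimality: an element with smaller support than
    \<open>?y\<close> has smaller support than \<open>x\<close>.\<close>
  then have "card (supp ?y) \<le> card ((\<lambda>k. k \<star> ginv g) ` supp x)"
    by (intro card_mono finite_imageI finite_supp[OF xS])
  also have "\<dots> \<le> card (supp x)" by (rule card_image_le[OF finite_supp[OF xS]])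
  finally have card: "card (supp ?y) \<le> card (supp x)" .
  show ?thesis
  proof (rule that[OF y ye], rule ccontr)
    fix z assume z: "z \<in> J" "card (supp z) < card (supp ?y)" "z \<noteq> \<zero>\<^bsub>S\<^esub>"
    then have "card (supp x) \<le> card (supp z)" by (intro min) simp
    with z card show False by simp
  qed
qed

text \<open>Normalizing the coefficient at \<open>e\<close> to \<open>\<one>\<close> makes one
  coefficient of each commutator cancel. The commutator with a generator then has fewer nonzero
  coefficients than the minimum, so it is zero.\<close>

lemma ideal_contains_central:
  assumes J: "ideal J S" and ne: "J \<noteq> {\<zero>\<^bsub>S\<^esub>}" and as: "alpha_simple G R D \<alpha>"
  obtains y where "y \<in> J" "y e = \<one>" "\<And>x. x \<in> carrier S \<Longrightarrow> y \<odot> x = x \<odot> y"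
proof -
  interpret S: ring S by (rule ring_S)
  interpret J: ideal J S by (rule J)
  obtain x where x: "x \<in> J" "x e \<noteq> \<zero>"
    and min: "\<And>z. \<lbrakk>z \<in> J; card (supp z) < card (supp x)\<rbrakk> \<Longrightarrow> z = \<zero>\<^bsub>S\<^esub>"
    by (rule ideal_minimal_support[OF J ne]) blast
  have xS: "x \<in> carrier S" by (rule J.Icarr[OF x(1)])
  let ?F = "supp x"
  have F: "finite ?F" by (rule finite_supp[OF xS])
  have small: "z = \<zero>\<^bsub>S\<^esub>"
    if "z \<in> J" "finite A" "card A \<le> card ?F" "h \<in> A" "supp z \<subseteq> A - {h}" for z A h
  proof (rule min[OF that(1)])
    have "card (supp z) \<le> card (A - {h})" using that by (intro card_mono) auto
    also have "\<dots> < card A" using that by (intro card_Diff1_less) auto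
    finally show "card (supp z) < card ?F" using that by simp
  qed
  have "x e \<in> coeff_ideal J ?F" using x(1) by (intro coeff_idealI) auto
  then have "coeff_ideal J ?F = carrier R"
    using as coeff_ideal_invariant[OF J, of ?F] x(2) unfolding alpha_simple_def by blast
  then have "\<one> \<in> coeff_ideal J ?F" by simp
  then obtain y where y: "y \<in> J" "supp y \<subseteq> ?F" "y e = \<one>" by (auto simp: coeff_ideal_def)
  have yS: "y \<in> carrier S" by (rule J.Icarr[OF y(1)])
  have y_out: "y k = \<zero>" if "k \<notin> ?F" for k using that y(2) by blast
  \<comment> \<open>Here \<open>A\<close> contains the supports of both products and is no larger
    than the minimal support, while \<open>h\<close> is the point at which their coefficients
    cancel.\<close>
  have commute: "m \<odot> y = y \<odot> m"
    if m: "m \<in> carrier S" and A: "finite A" "card A \<le> card ?F" "h \<in> A"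
      and h: "(m \<odot> y) h = (y \<odot> m) h"
      and out: "\<And>k. \<lbrakk>k \<in> carrier G; k \<notin> A\<rbrakk> \<Longrightarrow> (m \<odot> y) k = \<zero> \<and> (y \<odot> m) k = \<zero>" for m A h
  proof -
    let ?z = "m \<odot> y \<ominus>\<^bsub>S\<^esub> y \<odot> m"
    have J2: "m \<odot> y \<in> J" "y \<odot> m \<in> J" using y m by (auto intro: J.I_l_closed J.I_r_closed)
    note S2 = J.Icarr[OF J2(1)] J.Icarr[OF J2(2)]
    have zJ: "?z \<in> J"
      unfolding a_minus_def using J2
      by (intro additive_subgroup.a_closed[OF J.additive_subgroup_axioms] J.a_inv_closed)
    have zk: "?z k = (m \<odot> y) k \<oplus> \<ominus> (y \<odot> m) k" for k
      using S2 by (simp add: a_minus_def add_S minus_S)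
    have "supp ?z \<subseteq> A - {h}"
    proof
      fix k assume k: "k \<in> supp ?z"
      then have kG: "k \<in> carrier G" using supp_subset[OF J.Icarr[OF zJ]] by blast
      have "k \<noteq> h" using k h coeff_closed[OF S2(2)] by (auto simp: zk rng.r_neg)
      moreover have "k \<in> A"
        using k out[OF kG] by (cases "k \<in> A") (simp_all add: zk)
      ultimately show "k \<in> A - {h}" by simp
    qed
    from small[OF zJ A this] have "?z = \<zero>\<^bsub>S\<^esub>" .
    then show ?thesis using S2 by (simp add: S.r_right_minus_eq)
  qed
  have "y \<odot> z = z \<odot> y" if z: "z \<in> carrier S" for z
  proof (rule commutes_with_allI[OF yS _ _ z])
    fix r assume r: "r \<in> carrier R"
    have m: "monomial e r \<in> carrier S" using r by (intro monomial_closed) (auto simp: D_one)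
    show "monomial e r \<odot> y = y \<odot> monomial e r"
      \<comment> \<open>Both products are supported in \<open>?F\<close> and have coefficient
        \<open>r\<close> at \<open>e\<close>.\<close>
      by (rule commute[OF m F, of e])
        (use x(2) y(3) y_out r yS in
          \<open>simp_all add: base_smult smult_base \<beta>_one \<beta>_closed\<close>)
  next
    fix g assume g: "g \<in> carrier G"
    \<comment> \<open>Left and right translates of \<open>?F\<close> by \<open>g\<close> agree
      because \<open>G\<close> is abelian, so \<open>?A\<close> holds both supports; at
      \<open>g\<close> both coefficients are \<open>u g\<close>.\<close>
    let ?A = "(\<lambda>k. g \<star> k) ` ?F"
    have m: "monomial g (u g) \<in> carrier S" using g by (intro monomial_closed u_in_D)
    have card: "card ?A \<le> card ?F" by (rule card_image_le[OF F])
    have mem: "g \<in> ?A" using x(2) g by (auto intro!: image_eqI[of _ _ e])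
    have yk: "y (ginv g \<star> k) = \<zero> \<and> y (k \<star> ginv g) = \<zero>" if k: "k \<in> carrier G" "k \<notin> ?A" for k
    proof -
      have "ginv g \<star> k \<notin> ?F" using k inv_star_cancel[OF g k(1)] by (metis image_eqI)
      then have "y (ginv g \<star> k) = \<zero>" using y(2) by auto
      then show ?thesis using comm[of "ginv g" k] g k by simp
    qed
    show "monomial g (u g) \<odot> y = y \<odot> monomial g (u g)"
    proof (rule commute[OF m finite_imageI[OF F] card mem])
      show "(monomial g (u g) \<odot> y) g = (y \<odot> monomial g (u g)) g"
        using g yS y(3) by (simp add: monomial_smult smult_monomial u_in_D \<beta>_unit \<beta>_one
            w_one_right w_one_left u_closed u_idem)
    qed (use g yS yk in \<open>auto simp: monomial_smult smult_monomial u_in_D \<beta>_zero \<beta>_closed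
        u_closed w_closed\<close>)
  qed
  then show ?thesis by (rule that[OF y(1,3)])
qed

section \<open>From a central element to simplicity, and the equivalence\<close>

lemma alpha_simple_imp_simple:
  assumes field: "field (ring_center S)" and as: "alpha_simple G R D \<alpha>"
  shows "simple_ring S"
proof -
  interpret S: ring S by (rule ring_S)
  interpret Z: field "ring_center S" by (rule field)
  \<comment> \<open>The center shares zero and one with the whole ring. The field condition thus
    excludes the zero ring, which \<open>alpha_simple\<close> admits.\<close>
  have ne: "\<one>\<^bsub>S\<^esub> \<noteq> \<zero>\<^bsub>S\<^esub>" using Z.one_not_zero by (simp add: ring_center_def)
  show ?thesis
  proof (intro simple_ring.intro ring_S simple_ring_axioms.intro ne)
    fix J assume J: "ideal J S"
    show "J = {\<zero>\<^bsub>S\<^esub>} \<or> J = carrier S"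
    proof (cases "J = {\<zero>\<^bsub>S\<^esub>}")
      case False
      interpret J: ideal J S by (rule J)
      obtain y where y: "y \<in> J" "y e = \<one>" "\<And>x. x \<in> carrier S \<Longrightarrow> y \<odot> x = x \<odot> y"
        by (rule ideal_contains_central[OF J False as]) blast
      \<comment> \<open>Otherwise \<open>\<one> = y e = \<zero>\<close> in \<open>R\<close>, and
        then the identity of the crossed product would be zero.\<close>
      have "y \<noteq> \<zero>\<^bsub>S\<^esub>"
        using ne y(2) by (auto simp: zero_S one_S)
      then have "y \<in> carrier (ring_center S) - {\<zero>\<^bsub>ring_center S\<^esub>}"
        using y J.Icarr by (simp add: ring_center_def)
      then have "y \<in> Units (ring_center S)" by (simp only: Z.field_Units)
      then obtain v where "v \<in> carrier S" "y \<odot> v = \<one>\<^bsub>S\<^esub>"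
        by (auto simp: Units_def ring_center_def)
      then have "\<one>\<^bsub>S\<^esub> \<in> J" using J.I_r_closed[OF y(1)] by metis
      then show ?thesis using J.one_imp_carrier by simp
    qed simp
  qed
qed

end

theorem theorem2p25:
  fixes G :: "('g, 'n) monoid_scheme"
    and R :: "('a, 'm) ring_scheme"
    and D :: "'g \<Rightarrow> 'a set"
    and u :: "'g \<Rightarrow> 'a"
    and \<alpha> :: "'g \<Rightarrow> 'a \<Rightarrow> 'a"
    and w :: "'g \<Rightarrow> 'g \<Rightarrow> 'a"
  assumes "unital_twisted_partial_action G R D u \<alpha> w"
    and "comm_group G"
  shows "simple_ring (crossed_product G R D \<alpha> w) \<longleftrightarrow>
    field (ring_center (crossed_product G R D \<alpha> w)) \<and> alpha_simple G R D \<alpha>"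
proof -
  interpret abelian_crossed_system G R D u \<alpha> w
    by (intro abelian_crossed_system.intro crossed_system.intro abelian_crossed_system_axioms.intro
        assms(1) comm_monoid.m_comm[OF comm_group.axioms(1)[OF assms(2)]])
  show ?thesis
    using simple_ring.field_center simple_imp_alpha_simple alpha_simple_imp_simple by blast
qed

end
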